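(* Let $s\in\mathbb{N}_+$. There exists a constant $c>0$, independent of $f$ and $n$ (it may depend on $s$), such that for every real-valued $f\in C^s[0,1]$ with $f(0),f(1),f'(0),f'(1)\in\mathbb{Z}$ and $f^{(i)}(0)=f^{(i)}(1)=0$ for $i=2,\dots,s$, and for every $n\in\mathbb{N}_+$: if $s=1$, \[ \|(\widehat{B}_n(f))'-f'\|\le c\left(\omega_\varphi^2(f',n^{-1/2})+\omega_1(f',n^{-1})+\frac1n\right), \] and if $s\ge 2$, \[ \|(\widehat{B}_n(f))^{(s)}-f^{(s)}\|\le c\left(\omega_\varphi^2(f^{(s)},n^{-1/2})+\omega_1(f^{(s)},n^{-1})+\frac1n\,\|f^{(s)}\|+\frac1n\right). \]
   Context: $\mathbb{N}_+$ is the set of positive integers. $\|\cdot\|$ is the sup-norm on $[0,1]$. $C^s[0,1]$ is the space of real functions with $s$ continuous derivatives on $[0,1]$ (one-sided at the endpoints). For real $\alpha$, $\langle\alpha\rangle$ denotes the nearest integer to $\alpha$, i.e. an integer at which $\min_{m\in\mathbb{Z}}|\alpha-m|$ is attained. When $\alpha=m+1/2$ with $m\in\mathbb{Z}$, $\langle\alpha\rangle$ is $m$ or $m+1$ according to some tie-breaking rule; the result is asserted for any tie-breaking rule (round half up, down, towards zero, away from zero, to even, to odd, random, or any mixture of these). For $f\in C[0,1]$, $n\in\mathbb{N}_+$, $x\in[0,1]$, \[ \widehat{B}_n(f)(x):=\sum_{k=0}^n\left\langle f\left(\frac kn\right)\binom nk\right\rangle x^k(1-x)^{n-k}. \] $\omega_1(F,t):=\sup\{|F(x)-F(y)|: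 x,y\in[0,1],\ |x-y|\le t\}$ is the ordinary modulus of continuity. $\omega_\varphi^2(F,t)$ is the Ditzian–Totik modulus of smoothness of second order in the uniform norm on $[0,1]$ with weight $\varphi(x):=\sqrt{x(1-x)}$: \[ \omega_\varphi^2(F,t):=\sup_{0<h\le t}\ \sup_{x}\left|F(x+h\varphi(x))-2F(x)+F(x-h\varphi(x))\right|, \] where the inner supremum is over $x\in[0,1]$ with $x\pm h\varphi(x)\in[0,1]$. *)

theory Defs
  imports "HOL-Analysis.Analysis"
begin

text \<open>Functions on \<open>[0,1]\<close> are total functions on the reals. Every notion below depends only on
  their values on \<open>{0..1}\<close>. (Values of derivatives outside \<open>{0..1}\<close> are junk and are never used.)\<close>

text \<open>The derivative of order \<open>i\<close> on \<open>[0,1]\<close>. Taking limits within \<open>{0..1}\<close> makes it one-sided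
  at \<open>0\<close> and \<open>1\<close>.\<close>

definition deriv01 :: "nat \<Rightarrow> (real \<Rightarrow> real) \<Rightarrow> real \<Rightarrow> real" where
  "deriv01 i f = ((\<lambda>g x. vector_derivative g (at x within {0..1})) ^^ i) f"

text \<open>Continuity of the derivatives of order less than \<open>s\<close> follows from their differentiability.\<close>

definition Cs01 :: "nat \<Rightarrow> (real \<Rightarrow> real) set" where
  "Cs01 s = {f. (\<forall>i<s. deriv01 i f differentiable_on {0..1}) \<and> continuous_on {0..1} (deriv01 s f)}"

definition supnorm01 :: "(real \<Rightarrow> real) \<Rightarrow> real" where
  "supnorm01 F = (SUP x\<in>{0..1}. \<bar>F x\<bar>)"

definition omega1 :: "(real \<Rightarrow> real) \<Rightarrow> real \<Rightarrow> real" where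
  "omega1 F t = (SUP (x, y)\<in>{(x, y). x \<in> {0..1} \<and> y \<in> {0..1} \<and> \<bar>x - y\<bar> \<le> t}. \<bar>F x - F y\<bar>)"

definition phi :: "real \<Rightarrow> real" where
  "phi x = sqrt (x * (1 - x))"

definition omega2_phi :: "(real \<Rightarrow> real) \<Rightarrow> real \<Rightarrow> real" where
  "omega2_phi F t =
     (SUP h\<in>{0<..t}. SUP x\<in>{x \<in> {0..1}. x + h * phi x \<in> {0..1} \<and> x - h * phi x \<in> {0..1}}.
        \<bar>F (x + h * phi x) - 2 * F x + F (x - h * phi x)\<bar>)"

text \<open>Rounding to a nearest integer. How ties are broken is left open.\<close>

definition nearest_int_rule :: "(real \<Rightarrow> int) \<Rightarrow> bool" where
  "nearest_int_rule r \<longleftrightarrow> (\<forall>a. \<forall>m::int. \<bar>a - of_int (r a)\<bar> \<le> \<bar>a - of_int m\<bar>)"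

text \<open>The rule \<open>r k\<close> rounds the coefficient of index \<open>k\<close>. Letting the rule vary with \<open>k\<close> covers random
  and mixed tie-breaking, where equal values may be rounded differently.\<close>

definition Bhat :: "(nat \<Rightarrow> real \<Rightarrow> int) \<Rightarrow> nat \<Rightarrow> (real \<Rightarrow> real) \<Rightarrow> real \<Rightarrow> real" where
  "Bhat r n f x =
     (\<Sum>k=0..n. of_int (r k (f (real k / real n) * real (n choose k))) * x ^ k * (1 - x) ^ (n - k))"

end

theory Submission
  imports Defs
begin

text \<open>Write \<open>Bhat r n f\<close> as the Bernstein form with coefficients \<open>f (k / n) + b k\<close>, where \<open>b k\<close> is the
  rounding error divided by \<open>n choose k\<close>. Its derivative of order \<open>s\<close> is the Bernstein form of degree
  \<open>n - s\<close> of the differences of order \<open>s\<close> of these coefficients, times \<open>n (n - 1) \<dots> (n - s + 1)\<close>. So the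
  rounding errors matter only through \<open>n ^ s * \<bar>b k\<bar>\<close>, and the rest is a statement on \<open>F = deriv01 s f\<close>.

  Rounding (\<open>rounding_error_scaled_le\<close>). For \<open>s < k < n - s\<close> the binomial coefficient is of order at
  least \<open>n ^ (s + 1)\<close>, which makes \<open>n ^ s * \<bar>b k\<bar>\<close> of order \<open>1 / n\<close>. For \<open>k \<le> s\<close> the hypotheses at \<open>0\<close> say
  that the Taylor polynomial of \<open>f\<close> is a line with integer coefficients, whose value at \<open>k / n\<close> times
  \<open>n choose k\<close> is an integer. The nearest integer is at least as good, so \<open>\<bar>b k\<bar>\<close> is at most the Taylor
  remainder, which is of order \<open>omega1 F (1 / n) / n ^ s\<close>. The indices near \<open>n\<close> are symmetric.

  Approximation. By a mean value theorem for differences the remaining sum is a mean of values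
  \<open>F (\<xi> k)\<close> with the Bernstein weights of degree \<open>n - s\<close>; moving the points \<open>\<xi> k\<close> to \<open>k / (n - s)\<close> costs a
  multiple of \<open>omega1 F (1 / n)\<close> (\<open>Bernstein_displaced_nodes\<close>). Replacing the product
  \<open>n (n - 1) \<dots> (n - s + 1)\<close> by \<open>n ^ s\<close> costs a multiple of \<open>supnorm01 F / n\<close>, and nothing for \<open>s = 1\<close>.

  What is left is the direct estimate of a Bernstein polynomial by the two moduli
  (\<open>Bernstein_approximation\<close>). The substitution \<open>x = (1 - cos \<theta>) / 2\<close> turns \<open>F\<close> into an even periodic
  function \<open>g\<close> on the line. Weighted second differences of \<open>F\<close> become ordinary ones of \<open>g\<close> up to shifts
  of order \<open>t\<^sup>2\<close>, which \<open>omega1\<close> absorbs (\<open>cosine_second_difference_le\<close>). The Steklov mean \<open>S\<close> of \<open>g\<close> is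
  close to \<open>g\<close> and has a second derivative controlled by second differences of \<open>g\<close> (\<open>steklov_mean\<close>). By
  symmetry \<open>S\<close> is stationary at \<open>0\<close> and \<open>pi\<close>, so its tangents in the variable \<open>x\<close> have slopes bounded
  uniformly in \<open>\<theta>\<close> and remainders of order \<open>(\<eta> - \<theta>)\<^sup>2\<close>; the variance of the Bernstein weights bounds
  the mean of these remainders by a multiple of \<open>1 / m\<close>, uniformly up to the endpoints
  (\<open>Bernstein_smooth_in_angle\<close>).\<close>

section \<open>The moduli of smoothness as bounds on differences\<close>

lemma bounded_on_unit_interval:
  assumes "continuous_on {0..1} (F :: real \<Rightarrow> real)"
  obtains M where "\<And>x. x \<in> {0..1} \<Longrightarrow> \<bar>F x\<bar> \<le> M"
proof -
  have "bounded (F ` {0..1})"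
    using assms by (intro compact_imp_bounded compact_continuous_image) auto
  then show ?thesis
    using that unfolding bounded_iff by (metis imageI real_norm_def)
qed

lemma supnorm01_upper:
  assumes "continuous_on {0..1} F" "x \<in> {0..1}"
  shows "\<bar>F x\<bar> \<le> supnorm01 F"
proof -
  obtain M where "\<And>x. x \<in> {0..1} \<Longrightarrow> \<bar>F x\<bar> \<le> M"
    using bounded_on_unit_interval[OF assms(1)] by blast
  then have "bdd_above ((\<lambda>x. \<bar>F x\<bar>) ` {0..1})"
    by (intro bdd_aboveI2) auto
  then show ?thesis
    unfolding supnorm01_def using assms(2) by (intro cSUP_upper)
qed

lemma supnorm01_least:
  assumes "\<And>x. x \<in> {0..1} \<Longrightarrow> \<bar>F x\<bar> \<le> M"
  shows "supnorm01 F \<le> M"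
  unfolding supnorm01_def using assms by (intro cSUP_least) auto

lemma omega1_upper:
  assumes "continuous_on {0..1} F" "x \<in> {0..1}" "y \<in> {0..1}" "\<bar>x - y\<bar> \<le> t"
  shows "\<bar>F x - F y\<bar> \<le> omega1 F t"
proof -
  let ?A = "{(x, y). x \<in> {0..1} \<and> y \<in> {0..1} \<and> \<bar>x - y\<bar> \<le> t}"
  obtain M where M: "\<And>x. x \<in> {0..1} \<Longrightarrow> \<bar>F x\<bar> \<le> M"
    using bounded_on_unit_interval[OF assms(1)] by blast
  have "\<bar>F x - F y\<bar> \<le> 2 * M" if "x \<in> {0..1}" "y \<in> {0..1}" for x y
    using M[OF that(1)] M[OF that(2)] by linarith
  then have "bdd_above ((\<lambda>(x, y). \<bar>F x - F y\<bar>) ` ?A)"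
    by (intro bdd_aboveI2[where M = "2 * M"]) (auto split: prod.splits)
  then have "(\<lambda>(x, y). \<bar>F x - F y\<bar>) (x, y) \<le> omega1 F t"
    unfolding omega1_def using assms by (intro cSUP_upper) auto
  then show ?thesis by simp
qed

lemma omega1_nonneg:
  assumes "continuous_on {0..1} F" "0 \<le> t"
  shows "0 \<le> omega1 F t"
  using omega1_upper[OF assms(1), of 0 0 t] assms(2) by simp

text \<open>Subadditivity of \<open>omega1\<close>: two points at distance at most \<open>N * t\<close> are joined by \<open>N\<close> steps
  of length at most \<open>t\<close>.\<close>

lemma omega1_chain:
  assumes "continuous_on {0..1} F" "0 \<le> t"
  shows "x \<in> {0..1} \<Longrightarrow> y \<in> {0..1} \<Longrightarrow> \<bar>x - y\<bar> \<le> real N * t \<Longrightarrow> \<bar>F x - F y\<bar> \<le> real N * omega1 F t"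
proof (induction N arbitrary: y)
  case 0
  then show ?case by simp
next
  case (Suc N)
  define z where "z = x + (y - x) * (real N / real (Suc N))"
  have zy: "\<bar>z - y\<bar> = \<bar>x - y\<bar> / real (Suc N)"
  proof -
    have "z - y = (x - y) / real (Suc N)"
      unfolding z_def by (simp add: field_simps)
    then show ?thesis by (simp add: abs_divide)
  qed
  have xz: "\<bar>x - z\<bar> = \<bar>x - y\<bar> / real (Suc N) * real N"
  proof -
    have "x - z = (x - y) / real (Suc N) * real N"
      unfolding z_def by (simp add: field_simps)
    then show ?thesis by (simp add: abs_divide abs_mult)
  qed
  have step: "\<bar>x - y\<bar> / real (Suc N) \<le> t"
    using Suc.prems(3) by (simp add: field_simps)
  have "z \<in> {0..1}"
  proof -
    define l where "l = real N / real (Suc N)"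
    have l: "0 \<le> l" "l \<le> 1" by (auto simp: l_def)
    have "z = (1 - l) * x + l * y"
      unfolding z_def l_def[symmetric] by (simp add: algebra_simps)
    then show ?thesis
      using convexD_alt[OF convex_real_interval(5)[of 0 1] Suc.prems(1,2) l] by simp
  qed
  moreover have "\<bar>x - z\<bar> \<le> real N * t"
    using mult_right_mono[OF step, of "real N"] xz by (simp add: mult.commute)
  ultimately have "\<bar>F x - F z\<bar> \<le> real N * omega1 F t"
    using Suc by blast
  moreover have "\<bar>F z - F y\<bar> \<le> omega1 F t"
    using omega1_upper[OF assms(1) \<open>z \<in> {0..1}\<close> Suc.prems(2)] zy step by simp
  ultimately show ?case by (simp add: algebra_simps)
qed

lemma omega2_phi_upper:
  assumes "continuous_on {0..1} F" "0 < h" "h \<le> t" "x \<in> {0..1}"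
    and "x + h * phi x \<in> {0..1}" "x - h * phi x \<in> {0..1}"
  shows "\<bar>F (x + h * phi x) - 2 * F x + F (x - h * phi x)\<bar> \<le> omega2_phi F t"
proof -
  let ?X = "\<lambda>h. {x \<in> {0..1}. x + h * phi x \<in> {0..1} \<and> x - h * phi x \<in> {0..1}}"
  let ?d = "\<lambda>h x. \<bar>F (x + h * phi x) - 2 * F x + F (x - h * phi x)\<bar>"
  obtain M where M: "\<And>x. x \<in> {0..1} \<Longrightarrow> \<bar>F x\<bar> \<le> M"
    using bounded_on_unit_interval[OF assms(1)] by blast
  have d: "?d h x \<le> 4 * M" if "x \<in> ?X h" for h x
    using that M[of x] M[of "x + h * phi x"] M[of "x - h * phi x"] by auto
  have "0 \<in> ?X h" for h
    by (simp add: phi_def)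
  then have ne: "?X h \<noteq> {}" for h by blast
  have "?d h x \<le> (SUP x\<in>?X h. ?d h x)"
    using assms d by (intro cSUP_upper bdd_aboveI2[where M = "4 * M"]) auto
  also have "\<dots> \<le> omega2_phi F t"
    unfolding omega2_phi_def using assms d ne
    by (intro cSUP_upper bdd_aboveI2[where M = "4 * M"] cSUP_least) auto
  finally show ?thesis .
qed

lemma omega2_phi_nonneg:
  assumes "continuous_on {0..1} F" "0 < t"
  shows "0 \<le> omega2_phi F t"
  using omega2_phi_upper[OF assms(1), of t t 0] assms(2) by (simp add: phi_def)

section \<open>The substitution by the cosine\<close>

lemma cosine_point_in_unit_interval: "(1 - cos \<theta>) / 2 \<in> {0..1::real}"
  using cos_ge_minus_one[of \<theta>] cos_le_one[of \<theta>] by simp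

lemma phi_cosine: "phi ((1 - cos \<theta>) / 2) = \<bar>sin \<theta>\<bar> / 2"
proof -
  have "(1 - cos \<theta>) / 2 * (1 - (1 - cos \<theta>) / 2) = (sin \<theta> / 2)\<^sup>2"
  proof -
    have "(1 - cos \<theta>) / 2 * (1 - (1 - cos \<theta>) / 2) = (1 - (cos \<theta>)\<^sup>2) / 4"
      by (simp add: power2_eq_square field_simps)
    then show ?thesis
      by (simp add: sin_squared_eq[symmetric] power_divide)
  qed
  then show ?thesis
    unfolding phi_def by simp
qed

lemma one_minus_cos_le: "1 - cos h \<le> h\<^sup>2 / (2::real)"
proof -
  have "1 - cos h = 2 * (sin (h / 2))\<^sup>2"
    using cos_double_sin[of "h / 2"] by simp
  moreover have "(sin (h / 2))\<^sup>2 \<le> (h / 2)\<^sup>2"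
    unfolding abs_le_square_iff[symmetric] by (rule abs_sin_x_le_abs_x)
  ultimately show ?thesis by (simp add: power2_eq_square)
qed

text \<open>In the variable \<open>\<theta>\<close> with \<open>x = (1 - cos \<theta>) / 2\<close> one has \<open>phi x = \<bar>sin \<theta>\<bar> / 2 = \<bar>dx/d\<theta>\<bar>\<close>, so
  a step of length \<open>h\<close> in \<open>\<theta>\<close> is a step of length \<open>sin h * phi x\<close> in \<open>x\<close>, up to an error of order
  \<open>h\<^sup>2\<close> that \<open>omega1\<close> absorbs. When the weighted step would leave \<open>[0,1]\<close>, then \<open>x\<close> is within \<open>h\<^sup>2\<close>
  of an endpoint, the step itself has length at most \<open>h\<^sup>2\<close>, and \<open>omega1\<close> alone is enough.\<close>

lemma cosine_second_difference_le:
  assumes F: "continuous_on {0..1} F" and h: "0 \<le> h" "h \<le> t" "t \<le> 1" "0 < t"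
  shows "\<bar>F ((1 - cos (\<theta> + h)) / 2) - 2 * F ((1 - cos \<theta>) / 2) + F ((1 - cos (\<theta> - h)) / 2)\<bar>
    \<le> omega2_phi F t + 4 * omega1 F (t\<^sup>2)"
proof (cases "h = 0")
  case True
  then show ?thesis
    using omega2_phi_nonneg[OF F, of t] omega1_nonneg[OF F, of "t\<^sup>2"] h by simp
next
  case False
  define x where "x = (1 - cos \<theta>) / 2"
  define p q where "p = (1 - cos (\<theta> + h)) / 2" and "q = (1 - cos (\<theta> - h)) / 2"
  define \<sigma> where "\<sigma> = sin h"
  define e where "e = cos \<theta> * (1 - cos h) / 2"
  define w where "w = \<sigma> * phi x"
  have xpq: "x \<in> {0..1}" "p \<in> {0..1}" "q \<in> {0..1}"
    unfolding x_def p_def q_def by (rule cosine_point_in_unit_interval)+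
  have \<sigma>: "0 < \<sigma>" "\<sigma> \<le> h"
    unfolding \<sigma>_def using False h pi_gt3 by (auto intro!: sin_gt_zero sin_x_le_x)
  have h2: "h\<^sup>2 \<le> t\<^sup>2" using h by (intro power_mono) auto
  have e: "\<bar>e\<bar> \<le> h\<^sup>2 / 4"
  proof -
    have "\<bar>e\<bar> = \<bar>cos \<theta>\<bar> * \<bar>1 - cos h\<bar> / 2"
      unfolding e_def by (simp add: abs_mult)
    also have "\<dots> \<le> 1 * \<bar>1 - cos h\<bar> / 2"
      by (intro divide_right_mono mult_right_mono) auto
    also have "\<dots> \<le> h\<^sup>2 / 4"
      using one_minus_cos_le[of h] cos_le_one[of h] by simp
    finally show ?thesis .
  qed
  have p: "p = x + e + sin \<theta> * \<sigma> / 2" and q: "q = x + e - sin \<theta> * \<sigma> / 2"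
    unfolding p_def q_def x_def e_def \<sigma>_def cos_add cos_diff by (simp_all add: field_simps)
  have w: "w = \<bar>sin \<theta>\<bar> * \<sigma> / 2"
    unfolding w_def x_def phi_cosine by simp
  (* The sign of sin \<theta> only decides which of the two shifted points lies on the left. *)
  obtain a b where ab: "a = x + e + w" "b = x + e - w" "a \<in> {0..1}" "b \<in> {0..1}"
    "F p + F q = F a + F b"
  proof (cases "0 \<le> sin \<theta>")
    case True
    then show ?thesis using that[of p q] p q w xpq by simp
  next
    case False
    then show ?thesis using that[of q p] p q w xpq by (simp add: field_simps)
  qed
  have "\<bar>F a - 2 * F x + F b\<bar> \<le> omega2_phi F t + 4 * omega1 F (t\<^sup>2)"
  proof (cases "x + w \<in> {0..1} \<and> x - w \<in> {0..1}")
    case True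
    have "\<bar>F (x + w) - 2 * F x + F (x - w)\<bar> \<le> omega2_phi F t"
      using omega2_phi_upper[OF F, of \<sigma> t x] True \<sigma> h xpq unfolding w_def by simp
    moreover have "\<bar>F a - F (x + w)\<bar> \<le> omega1 F (t\<^sup>2)" "\<bar>F b - F (x - w)\<bar> \<le> omega1 F (t\<^sup>2)"
      using True ab e h2 by (auto intro!: omega1_upper[OF F])
    ultimately show ?thesis
      using omega1_nonneg[OF F, of "t\<^sup>2"] by simp
  next
    case False
    have w0: "0 \<le> w" unfolding w using \<sigma> by simp
    have w2: "w\<^sup>2 = \<sigma>\<^sup>2 * (x * (1 - x))"
      unfolding w_def phi_def using xpq by (simp add: power_mult_distrib)
    have "w \<le> \<sigma>\<^sup>2"
    proof (cases "x < w")
      case True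
      have "w * w \<le> \<sigma>\<^sup>2 * x"
        using w2 xpq mult_left_mono[of "x * (1 - x)" x "\<sigma>\<^sup>2"]
        by (simp add: power2_eq_square mult_left_le)
      also have "\<dots> \<le> \<sigma>\<^sup>2 * w" using True by (intro mult_left_mono) auto
      finally show ?thesis using True xpq by simp
    next
      case False': False
      then have *: "1 - x < w" using False xpq w0 by auto
      have "w * w \<le> \<sigma>\<^sup>2 * (1 - x)"
        using w2 xpq mult_left_mono[of "x * (1 - x)" "1 - x" "\<sigma>\<^sup>2"]
        by (simp add: power2_eq_square mult_left_le_one_le)
      also have "\<dots> \<le> \<sigma>\<^sup>2 * w" using * by (intro mult_left_mono) auto
      finally show ?thesis using * xpq by simp
    qed
    moreover have "\<sigma>\<^sup>2 \<le> h\<^sup>2" using \<sigma> by (intro power_mono) auto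
    ultimately have "\<bar>a - x\<bar> \<le> real 2 * t\<^sup>2" "\<bar>b - x\<bar> \<le> real 2 * t\<^sup>2"
      using ab e h2 w0 by auto
    then have "\<bar>F a - F x\<bar> \<le> real 2 * omega1 F (t\<^sup>2)" "\<bar>F b - F x\<bar> \<le> real 2 * omega1 F (t\<^sup>2)"
      using omega1_chain[OF F zero_le_power2 ab(3) xpq(1)] omega1_chain[OF F zero_le_power2 ab(4) xpq(1)]
      by blast+
    then show ?thesis
      using omega2_phi_nonneg[OF F h(4)] by simp
  qed
  then show ?thesis
    using ab(5) unfolding x_def p_def q_def by (simp add: algebra_simps)
qed

section \<open>Smoothing with control of the second derivative\<close>

lemma second_order_remainder_le:
  fixes f :: "real \<Rightarrow> real"
  assumes "convex I"
    and f: "\<And>x. x \<in> I \<Longrightarrow> (f has_real_derivative f' x) (at x within I)"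
    and f': "\<And>x. x \<in> I \<Longrightarrow> (f' has_real_derivative f'' x) (at x within I)"
    and M: "\<And>x. x \<in> I \<Longrightarrow> \<bar>f'' x\<bar> \<le> M"
    and ab: "a \<in> I" "b \<in> I"
  shows "\<bar>f b - f a - f' a * (b - a)\<bar> \<le> M * (b - a)\<^sup>2"
proof -
  let ?J = "closed_segment a b"
  have J: "?J \<subseteq> I" using assms closed_segment_subset by blast
  have f'a: "\<bar>f' x - f' a\<bar> \<le> M * \<bar>b - a\<bar>" if "x \<in> ?J" for x
  proof -
    have "norm (f' x - f' a) \<le> M * norm (x - a)"
      using f' M that J ab by (intro field_differentiable_bound[OF \<open>convex I\<close>]) auto
    also have "\<dots> \<le> M * \<bar>b - a\<bar>"
      using segment_bound1[OF that] M[OF ab(1)] by (intro mult_left_mono) (auto simp: norm_minus_commute)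
    finally show ?thesis by simp
  qed
  let ?g = "\<lambda>x. f x - f a - f' a * (x - a)"
  have g': "(?g has_real_derivative (f' x - f' a)) (at x within ?J)" if "x \<in> ?J" for x
    using DERIV_subset[OF f J, of x] that J by (auto intro!: derivative_eq_intros)
  have "norm (?g b - ?g a) \<le> (M * \<bar>b - a\<bar>) * norm (b - a)"
    using f'a g' by (intro field_differentiable_bound[where S = ?J and f' = "\<lambda>x. f' x - f' a"]) auto
  then show ?thesis by (simp add: power2_eq_square)
qed

lemma continuous_has_primitive:
  fixes g :: "real \<Rightarrow> real"
  assumes "continuous_on UNIV g"
  obtains G where "\<And>x. (G has_real_derivative g x) (at x)"
proof -
  have "\<exists>G. \<forall>x::real. - \<infinity> < ereal x \<longrightarrow> ereal x < \<infinity> \<longrightarrow> (G has_vector_derivative g x) (at x)"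
    using assms by (intro einterval_antiderivative) (auto simp: continuous_on_eq_continuous_at)
  then show ?thesis
    using that by (auto simp: has_real_derivative_iff_has_vector_derivative)
qed

lemma primitive_of_symmetric:
  fixes G :: "real \<Rightarrow> real"
  assumes G: "\<And>x. (G has_real_derivative g x) (at x)" and sym: "\<And>u. g (a + u) = g (a - u)"
  shows "G (a + u) - 2 * G a + G (a - u) = 0"
proof -
  let ?H = "\<lambda>u. G (a + u) - 2 * G a + G (a - u)"
  have "(?H has_real_derivative 0) (at u)" for u
    by (rule derivative_eq_intros DERIV_chain2[OF G] refl)+ (simp add: sym)
  then have "?H u = ?H 0"
    using DERIV_isconst_all by blast
  then show ?thesis by simp
qed

text \<open>The second Steklov mean \<open>S\<close> of \<open>g\<close> is the second difference with step \<open>t\<close> of a twofold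
  primitive of \<open>g\<close>, divided by \<open>t\<^sup>2\<close>. Its second derivative is therefore a second difference of \<open>g\<close>,
  and its derivative vanishes at each centre of symmetry of \<open>g\<close>.\<close>

lemma steklov_mean:
  fixes g :: "real \<Rightarrow> real"
  assumes g: "continuous_on UNIV g" and t: "0 < t"
    and W: "\<And>\<theta> h. 0 \<le> h \<Longrightarrow> h \<le> t \<Longrightarrow> \<bar>g (\<theta> + h) - 2 * g \<theta> + g (\<theta> - h)\<bar> \<le> W"
  obtains S S' S'' where
    "\<And>\<theta>. (S has_real_derivative S' \<theta>) (at \<theta>)"
    "\<And>\<theta>. (S' has_real_derivative S'' \<theta>) (at \<theta>)"
    "\<And>\<theta>. \<bar>S'' \<theta>\<bar> \<le> W / t\<^sup>2"
    "\<And>\<theta>. \<bar>S \<theta> - g \<theta>\<bar> \<le> W"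
    "\<And>a. (\<And>u. g (a + u) = g (a - u)) \<Longrightarrow> S' a = 0"
proof -
  obtain G where G: "\<And>x. (G has_real_derivative g x) (at x)"
    using continuous_has_primitive[OF g] by blast
  have "continuous_on UNIV G"
    using G by (intro DERIV_continuous_on) auto
  then obtain K where K: "\<And>x. (K has_real_derivative G x) (at x)"
    using continuous_has_primitive by blast
  define S S' S'' where "S = (\<lambda>\<theta>. (K (\<theta> + t) - 2 * K \<theta> + K (\<theta> - t)) / t\<^sup>2)"
    and "S' = (\<lambda>\<theta>. (G (\<theta> + t) - 2 * G \<theta> + G (\<theta> - t)) / t\<^sup>2)"
    and "S'' = (\<lambda>\<theta>. (g (\<theta> + t) - 2 * g \<theta> + g (\<theta> - t)) / t\<^sup>2)"
  show ?thesis
  proof (rule that)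
    show "(S has_real_derivative S' \<theta>) (at \<theta>)" for \<theta>
      unfolding S_def S'_def 
      by (rule DERIV_cdivide) (rule derivative_eq_intros DERIV_chain2[OF K] K refl | simp)+
    show "(S' has_real_derivative S'' \<theta>) (at \<theta>)" for \<theta>
      unfolding S'_def S''_def 
      by (rule DERIV_cdivide) (rule derivative_eq_intros DERIV_chain2[OF G] G refl | simp)+
    show "\<bar>S'' \<theta>\<bar> \<le> W / t\<^sup>2" for \<theta>
      unfolding S''_def using W[of t \<theta>] t by (simp add: abs_divide divide_right_mono)
    show "S' a = 0" if "\<And>u. g (a + u) = g (a - u)" for a
      unfolding S'_def using primitive_of_symmetric[OF G that] by simp
    show "\<bar>S \<theta> - g \<theta>\<bar> \<le> W" for \<theta>
    proof -
      (* As a function of the step, t\<^sup>2 * (S \<theta> - g \<theta>) vanishes at 0 together with its derivative, and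
         its second derivative is a second difference of g. *)
      let ?H = "\<lambda>h. K (\<theta> + h) - 2 * K \<theta> + K (\<theta> - h) - h\<^sup>2 * g \<theta>"
      let ?H' = "\<lambda>h. G (\<theta> + h) - G (\<theta> - h) - 2 * h * g \<theta>"
      let ?H'' = "\<lambda>h. g (\<theta> + h) - 2 * g \<theta> + g (\<theta> - h)"
      have H: "(?H has_real_derivative ?H' h) (at h within {0..t})" for h
        by (rule DERIV_subset[OF _ subset_UNIV]) (rule derivative_eq_intros DERIV_chain2[OF K] refl | simp)+
      have H': "(?H' has_real_derivative ?H'' h) (at h within {0..t})" for h
        by (rule DERIV_subset[OF _ subset_UNIV]) (rule derivative_eq_intros DERIV_chain2[OF G] refl | simp)+
      have "\<bar>?H t - ?H 0 - ?H' 0 * (t - 0)\<bar> \<le> W * (t - 0)\<^sup>2"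
        using W t by (intro second_order_remainder_le[where I = "{0..t}", OF _ H H']) auto
      then have "\<bar>?H t\<bar> / t\<^sup>2 \<le> W"
        using t by (simp add: field_simps)
      moreover have "S \<theta> - g \<theta> = ?H t / t\<^sup>2"
        unfolding S_def using t by (simp add: diff_divide_distrib)
      ultimately show ?thesis by (simp add: abs_divide)
    qed
  qed
qed

section \<open>Uniform approximation by Bernstein polynomials\<close>

lemma half_le_sin:
  assumes "0 \<le> x" "x \<le> pi / 2"
  shows "x / 2 \<le> sin x"
proof -
  (* Halving brings the argument to at most pi / 4, where cos y * cos y >= 1 / 2; then
     sin x = 2 * sin y * cos y and y * cos y <= sin y give the bound. *)
  define y where "y = x / 2"
  have y: "0 \<le> y" "y \<le> pi / 4" using assms unfolding y_def by auto
  have "0 * cos 0 - sin 0 \<ge> y * cos y - sin y"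
  proof (rule DERIV_nonpos_imp_nonincreasing[where f = "\<lambda>y. y * cos y - sin y"])
    fix u assume u: "0 \<le> u" "u \<le> y"
    have "((\<lambda>y. y * cos y - sin y) has_real_derivative - (u * sin u)) (at u)"
      by (auto intro!: derivative_eq_intros)
    moreover have "0 \<le> u * sin u"
      using u y pi_gt_zero by (intro mult_nonneg_nonneg sin_ge_zero) linarith+
    ultimately show "\<exists>d. ((\<lambda>y. y * cos y - sin y) has_real_derivative d) (at u) \<and> d \<le> 0"
      by (metis neg_le_0_iff_le)
  qed (use y in auto)
  then have "y * cos y * cos y \<le> sin y * cos y"
    using y pi_gt_zero by (intro mult_right_mono cos_ge_zero) auto
  moreover have "1 / 2 \<le> cos y * cos y"
  proof -
    have "0 \<le> cos (2 * y)"
      using y pi_gt_zero by (intro cos_ge_zero) auto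
    then show ?thesis
      unfolding cos_double_cos by (simp add: power2_eq_square)
  qed
  then have "y * (1 / 2) \<le> y * (cos y * cos y)"
    using y by (intro mult_left_mono) auto
  ultimately have "y / 2 \<le> sin y * cos y" by simp
  then show ?thesis
    using sin_double[of y] unfolding y_def by simp
qed

lemma sin_le_two_sin_midpoint:
  assumes "0 \<le> \<theta>" "\<theta> \<le> pi" "0 \<le> \<eta>" "\<eta> \<le> pi"
  shows "sin \<theta> \<le> 2 * sin ((\<theta> + \<eta>) / 2)"
proof -
  have "sin ((\<theta> + \<eta>) / 2) = sin (\<theta> / 2) * cos (\<eta> / 2) + cos (\<theta> / 2) * sin (\<eta> / 2)"
    by (simp add: add_divide_distrib sin_add)
  moreover have s: "0 \<le> sin (\<theta> / 2)" "0 \<le> cos (\<theta> / 2)" "0 \<le> sin (\<eta> / 2)" "0 \<le> cos (\<eta> / 2)"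
    using assms by (auto intro!: sin_ge_zero cos_ge_zero)
  moreover have "sin (\<theta> / 2) * cos (\<theta> / 2) * cos (\<eta> / 2) \<le> sin (\<theta> / 2) * cos (\<eta> / 2)"
    "sin (\<theta> / 2) * cos (\<theta> / 2) * sin (\<eta> / 2) \<le> cos (\<theta> / 2) * sin (\<eta> / 2)"
    using s by (auto intro!: mult_right_mono mult_left_le mult_left_le_one_le)
  moreover have "1 \<le> cos (\<eta> / 2) + sin (\<eta> / 2)"
  proof -
    have "1\<^sup>2 \<le> (cos (\<eta> / 2) + sin (\<eta> / 2))\<^sup>2"
      using s sin_cos_squared_add[of "\<eta> / 2"] by (simp add: power2_sum)
    then show ?thesis
      using s by (intro power2_le_imp_le[of 1]) auto
  qed
  then have "sin (\<theta> / 2) * cos (\<theta> / 2) * 1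
      \<le> sin (\<theta> / 2) * cos (\<theta> / 2) * (cos (\<eta> / 2) + sin (\<eta> / 2))"
    using s by (intro mult_left_mono mult_nonneg_nonneg)
  ultimately show ?thesis
    using sin_double[of "\<theta> / 2"] by (simp add: distrib_left)
qed

text \<open>The difference of the cosines is a product of sines of the half sum and the half
  difference. Squared, the factor \<open>sin \<theta>\<close> becomes \<open>4 * x * (1 - x)\<close> with \<open>x = (1 - cos \<theta>) / 2\<close>,
  which is the factor that the variance of the Bernstein weights carries.\<close>

lemma angle_distance_le:
  assumes "0 \<le> \<theta>" "\<theta> \<le> pi" "0 \<le> \<eta>" "\<eta> \<le> pi"
  shows "sin \<theta> * \<bar>\<eta> - \<theta>\<bar> \<le> 8 * \<bar>(1 - cos \<eta>) / 2 - (1 - cos \<theta>) / 2\<bar>"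
proof -
  have "\<bar>(1 - cos \<eta>) / 2 - (1 - cos \<theta>) / 2\<bar> = \<bar>sin ((\<theta> + \<eta>) / 2) * sin ((\<eta> - \<theta>) / 2)\<bar>"
    using cos_diff_cos[of \<theta> \<eta>] by (simp add: field_simps)
  also have "\<dots> = \<bar>sin ((\<theta> + \<eta>) / 2)\<bar> * \<bar>sin ((\<eta> - \<theta>) / 2)\<bar>"
    by (rule abs_mult)
  also have "\<bar>sin ((\<eta> - \<theta>) / 2)\<bar> = \<bar>sin (\<bar>\<eta> - \<theta>\<bar> / 2)\<bar>"
    by (cases "\<eta> \<ge> \<theta>") (auto simp: minus_diff_eq[symmetric, of \<theta> \<eta>] simp del: minus_diff_eq)
  finally have *: "\<bar>(1 - cos \<eta>) / 2 - (1 - cos \<theta>) / 2\<bar>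
      = \<bar>sin ((\<theta> + \<eta>) / 2)\<bar> * \<bar>sin (\<bar>\<eta> - \<theta>\<bar> / 2)\<bar>" .
  have "sin \<theta> / 2 * (\<bar>\<eta> - \<theta>\<bar> / 2 / 2) \<le> \<bar>sin ((\<theta> + \<eta>) / 2)\<bar> * \<bar>sin (\<bar>\<eta> - \<theta>\<bar> / 2)\<bar>"
  proof (rule mult_mono)
    show "sin \<theta> / 2 \<le> \<bar>sin ((\<theta> + \<eta>) / 2)\<bar>"
      using sin_le_two_sin_midpoint[OF assms] by linarith
    show "\<bar>\<eta> - \<theta>\<bar> / 2 / 2 \<le> \<bar>sin (\<bar>\<eta> - \<theta>\<bar> / 2)\<bar>"
    proof -
      have "\<bar>\<eta> - \<theta>\<bar> \<le> pi" using assms by linarith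
      then show ?thesis
        by (intro order_trans[OF half_le_sin abs_ge_self]) auto
    qed
  qed auto
  with * show ?thesis by simp
qed

text \<open>A function that is smooth in \<open>\<theta>\<close> and stationary at \<open>0\<close> and \<open>pi\<close> has a tangent line with
  respect to \<open>x = (1 - cos \<theta>) / 2\<close>. Its slope \<open>2 * S' \<theta> / sin \<theta>\<close> is bounded because \<open>S'\<close> vanishes
  where the sine does; so the remainder is quadratic in \<open>\<theta>\<close>.\<close>

lemma tangent_in_cosine_variable:
  assumes S: "\<And>\<theta>. (S has_real_derivative S' \<theta>) (at \<theta>)"
    and S': "\<And>\<theta>. (S' has_real_derivative S'' \<theta>) (at \<theta>)"
    and M: "\<And>\<theta>. \<bar>S'' \<theta>\<bar> \<le> M"
    and stationary: "S' 0 = 0" "S' pi = 0"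
    and \<theta>: "0 < \<theta>" "\<theta> < pi"
  shows "\<bar>S \<eta> - S \<theta> - 2 * S' \<theta> / sin \<theta> * ((1 - cos \<eta>) / 2 - (1 - cos \<theta>) / 2)\<bar> \<le> 3 * M * (\<eta> - \<theta>)\<^sup>2"
proof -
  let ?x = "\<lambda>\<theta>. (1 - cos \<theta>) / 2"
  have sin0: "0 < sin \<theta>" using \<theta> by (rule sin_gt_zero)
  have M0: "0 \<le> M" using M[of 0] by linarith
  have Lip: "\<bar>S' \<theta> - S' a\<bar> \<le> M * \<bar>\<theta> - a\<bar>" for a
    using field_differentiable_bound[of UNIV S' S'' M \<theta> a] S' M by simp
  have slope: "\<bar>S' \<theta>\<bar> \<le> M * (2 * sin \<theta>)"
  proof (cases "\<theta> \<le> pi / 2")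
    case True
    have "\<bar>S' \<theta>\<bar> \<le> M * \<theta>" using Lip[of 0] stationary \<theta> by simp
    also have "\<dots> \<le> M * (2 * sin \<theta>)"
      using half_le_sin[of \<theta>] True \<theta> M0 by (intro mult_left_mono) auto
    finally show ?thesis .
  next
    case False
    have "\<bar>S' \<theta>\<bar> \<le> M * (pi - \<theta>)" using Lip[of pi] stationary \<theta> by simp
    also have "\<dots> \<le> M * (2 * sin \<theta>)"
      using half_le_sin[of "pi - \<theta>"] False \<theta> M0 by (intro mult_left_mono) auto
    finally show ?thesis .
  qed
  have x': "(?x has_real_derivative sin a / 2) (at a)" for a
    by (auto intro!: derivative_eq_intros)
  have x'': "((\<lambda>a. sin a / 2) has_real_derivative cos a / 2) (at a)" for a
    by (auto intro!: derivative_eq_intros)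
  have "\<bar>?x \<eta> - ?x \<theta> - sin \<theta> / 2 * (\<eta> - \<theta>)\<bar> \<le> 1 / 2 * (\<eta> - \<theta>)\<^sup>2"
    by (rule second_order_remainder_le[where I = UNIV, OF _ x' x'']) auto
  then have "\<bar>2 * S' \<theta> / sin \<theta>\<bar> * \<bar>?x \<eta> - ?x \<theta> - sin \<theta> / 2 * (\<eta> - \<theta>)\<bar> \<le> (4 * M) * (1 / 2 * (\<eta> - \<theta>)\<^sup>2)"
    using slope sin0 M0 by (intro mult_mono) (auto simp: abs_divide abs_mult field_simps)
  moreover have "\<bar>S \<eta> - S \<theta> - S' \<theta> * (\<eta> - \<theta>)\<bar> \<le> M * (\<eta> - \<theta>)\<^sup>2"
    using S S' M by (intro second_order_remainder_le[where I = UNIV]) auto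
  moreover have "S \<eta> - S \<theta> - 2 * S' \<theta> / sin \<theta> * (?x \<eta> - ?x \<theta>)
      = (S \<eta> - S \<theta> - S' \<theta> * (\<eta> - \<theta>)) - 2 * S' \<theta> / sin \<theta> * (?x \<eta> - ?x \<theta> - sin \<theta> / 2 * (\<eta> - \<theta>))"
    using sin0 by (simp add: field_simps)
  then have "\<bar>S \<eta> - S \<theta> - 2 * S' \<theta> / sin \<theta> * (?x \<eta> - ?x \<theta>)\<bar> \<le> \<bar>S \<eta> - S \<theta> - S' \<theta> * (\<eta> - \<theta>)\<bar>
      + \<bar>2 * S' \<theta> / sin \<theta>\<bar> * \<bar>?x \<eta> - ?x \<theta> - sin \<theta> / 2 * (\<eta> - \<theta>)\<bar>"
    unfolding abs_mult[symmetric] by (metis abs_triangle_ineq4)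
  ultimately have "\<bar>S \<eta> - S \<theta> - 2 * S' \<theta> / sin \<theta> * (?x \<eta> - ?x \<theta>)\<bar>
      \<le> M * (\<eta> - \<theta>)\<^sup>2 + (4 * M) * (1 / 2 * (\<eta> - \<theta>)\<^sup>2)"
    by (meson add_mono order_trans)
  then show ?thesis by simp
qed

lemma Bernstein_variance:
  assumes "0 < m"
  shows "(\<Sum>k\<le>m. (real k / real m - x)\<^sup>2 * Bernstein m k x) = x * (1 - x) / real m"
proof -
  have "(\<Sum>k\<le>m. (real k / real m - x)\<^sup>2 * Bernstein m k x)
      = (\<Sum>k\<le>m. (real k * (real k - 1) * Bernstein m k x) / (real m)\<^sup>2
          + (1 - 2 * real m * x) / (real m)\<^sup>2 * (real k * Bernstein m k x) + x\<^sup>2 * Bernstein m k x)"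
    using assms by (intro sum.cong refl) (simp add: power2_eq_square field_simps)
  also have "\<dots> = real m * (real m - 1) * x\<^sup>2 / (real m)\<^sup>2
      + (1 - 2 * real m * x) / (real m)\<^sup>2 * (real m * x) + x\<^sup>2"
    by (simp add: sum.distrib sum_divide_distrib[symmetric] sum_distrib_left[symmetric])
  also have "\<dots> = x * (1 - x) / real m"
    using assms by (simp add: power2_eq_square field_simps)
  finally show ?thesis .
qed

lemma Bernstein_centred:
  assumes "0 < m"
  shows "(\<Sum>k\<le>m. (real k / real m - x) * Bernstein m k x) = 0"
proof -
  have "(\<Sum>k\<le>m. (real k / real m - x) * Bernstein m k x)
      = (\<Sum>k\<le>m. real k * Bernstein m k x) / real m - x * (\<Sum>k\<le>m. Bernstein m k x)"
    unfolding sum_divide_distrib sum_distrib_left sum_subtractf[symmetric]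
    by (intro sum.cong refl) (simp add: left_diff_distrib)
  also have "\<dots> = 0" unfolding sum_k_Bernstein sum_Bernstein using assms by simp
  finally show ?thesis .
qed

lemma Bernstein_at_endpoints:
  "(\<Sum>k\<le>m. u k * Bernstein m k 0) = u 0"
  "(\<Sum>k\<le>m. u k * Bernstein m k 1) = u m"
proof -
  have "(\<Sum>k\<le>m. u k * Bernstein m k 0) = (\<Sum>k\<le>m. if k = 0 then u k else 0)"
    by (intro sum.cong refl) (auto simp: Bernstein_def)
  then show "(\<Sum>k\<le>m. u k * Bernstein m k 0) = u 0" by simp
  have "(\<Sum>k\<le>m. u k * Bernstein m k 1) = (\<Sum>k\<le>m. if k = m then u k else 0)"
    by (intro sum.cong refl) (auto simp: Bernstein_def)
  then show "(\<Sum>k\<le>m. u k * Bernstein m k 1) = u m" by simp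
qed

lemma Bernstein_mean_le:
  assumes "x \<in> {0..1}" "\<And>k. k \<le> m \<Longrightarrow> \<bar>u k\<bar> \<le> C"
  shows "\<bar>\<Sum>k\<le>m. u k * Bernstein m k x\<bar> \<le> C"
proof -
  have "\<bar>\<Sum>k\<le>m. u k * Bernstein m k x\<bar> \<le> (\<Sum>k\<le>m. C * Bernstein m k x)"
  proof (rule order_trans[OF sum_abs sum_mono])
    fix k assume "k \<in> {..m}"
    then show "\<bar>u k * Bernstein m k x\<bar> \<le> C * Bernstein m k x"
      using assms Bernstein_nonneg[of x m k] by (auto simp: abs_mult intro!: mult_right_mono)
  qed
  also have "\<dots> = C" by (simp add: sum_distrib_left[symmetric])
  finally show ?thesis .
qed

text \<open>Bernstein polynomials reproduce the tangent line, so only the quadratic remainder is left. At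
  the point \<open>x\<close> it is at most a constant times \<open>(y - x)\<^sup>2 / (x * (1 - x))\<close>, and the mean of
  \<open>(y - x)\<^sup>2\<close> is \<open>x * (1 - x) / m\<close>: the weight cancels.\<close>

lemma Bernstein_smooth_in_angle:
  assumes S: "\<And>\<theta>. (S has_real_derivative S' \<theta>) (at \<theta>)"
    and S': "\<And>\<theta>. (S' has_real_derivative S'' \<theta>) (at \<theta>)"
    and M: "\<And>\<theta>. \<bar>S'' \<theta>\<bar> \<le> M"
    and stationary: "S' 0 = 0" "S' pi = 0"
    and m: "0 < m" and x: "x \<in> {0..1}"
  shows "\<bar>(\<Sum>k\<le>m. (S (arccos (1 - 2 * (real k / real m))) - S (arccos (1 - 2 * x))) * Bernstein m k x)\<bar>
    \<le> 48 * M / real m"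
proof -
  let ?\<eta> = "\<lambda>y. arccos (1 - 2 * y)"
  have M0: "0 \<le> M" using M[of 0] by linarith
  have angle: "0 \<le> ?\<eta> y" "?\<eta> y \<le> pi" "(1 - cos (?\<eta> y)) / 2 = y" if "y \<in> {0..1}" for y
    using that arccos_lbound[of "1 - 2 * y"] arccos_ubound[of "1 - 2 * y"] by auto
  show ?thesis
  proof (cases "x = 0 \<or> x = 1")
    case True
    then show ?thesis
      using m M0 by (auto simp: Bernstein_at_endpoints)
  next
    case False
    define \<theta> where "\<theta> = ?\<eta> x"
    have x01: "0 < x" "x < 1" using False x by auto
    have \<theta>x: "(1 - cos \<theta>) / 2 = x" unfolding \<theta>_def using angle x by blast
    have "\<theta> \<noteq> 0" "\<theta> \<noteq> pi"
      using \<theta>x x01 by auto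
    then have \<theta>: "0 < \<theta>" "\<theta> < pi"
      using angle(1,2)[OF x] unfolding \<theta>_def by linarith+
    have sin2: "(sin \<theta>)\<^sup>2 = 4 * (x * (1 - x))"
    proof -
      have c: "cos \<theta> = 1 - 2 * x" using \<theta>x by simp
      show ?thesis
        unfolding sin_squared_eq c by (simp add: power2_eq_square algebra_simps)
    qed
    define \<kappa> where "\<kappa> = 2 * S' \<theta> / sin \<theta>"
    have pt: "\<bar>S (?\<eta> y) - S \<theta> - \<kappa> * (y - x)\<bar> \<le> 48 * M / (x * (1 - x)) * (y - x)\<^sup>2" if y: "y \<in> {0..1}" for y
    proof -
      have "(sin \<theta> * \<bar>?\<eta> y - \<theta>\<bar>)\<^sup>2 \<le> (8 * \<bar>y - x\<bar>)\<^sup>2"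
        using angle_distance_le[of \<theta> "?\<eta> y"] \<theta> angle[OF y] \<theta>x sin_gt_zero[OF \<theta>]
        by (intro power_mono) auto
      then have "(?\<eta> y - \<theta>)\<^sup>2 \<le> 16 / (x * (1 - x)) * (y - x)\<^sup>2"
        using x01 unfolding power_mult_distrib sin2 by (simp add: field_simps)
      then have "3 * M * (?\<eta> y - \<theta>)\<^sup>2 \<le> 3 * M * (16 / (x * (1 - x)) * (y - x)\<^sup>2)"
        using M0 by (intro mult_left_mono) auto
      then show ?thesis
        using tangent_in_cosine_variable[OF S S' M stationary \<theta>, of "?\<eta> y"] angle[OF y] \<theta>x
        unfolding \<kappa>_def by simp
    qed
    have pos: "0 \<le> Bernstein m k x" for k
      using x by (intro Bernstein_nonneg) auto
    let ?R = "\<Sum>k\<le>m. (S (?\<eta> (real k / real m)) - S \<theta> - \<kappa> * (real k / real m - x)) * Bernstein m k x"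
    have "(\<Sum>k\<le>m. (S (?\<eta> (real k / real m)) - S \<theta>) * Bernstein m k x)
        = (\<Sum>k\<le>m. (S (?\<eta> (real k / real m)) - S \<theta> - \<kappa> * (real k / real m - x)) * Bernstein m k x)
          + \<kappa> * (\<Sum>k\<le>m. (real k / real m - x) * Bernstein m k x)"
      by (simp add: sum_distrib_left sum.distrib[symmetric] algebra_simps)
    then have linear_part_vanishes: "(\<Sum>k\<le>m. (S (?\<eta> (real k / real m)) - S \<theta>) * Bernstein m k x) = ?R"
      unfolding Bernstein_centred[OF m] by simp
    have "\<bar>?R\<bar> \<le> (\<Sum>k\<le>m. 48 * M / (x * (1 - x)) * ((real k / real m - x)\<^sup>2 * Bernstein m k x))"
    proof (rule order_trans[OF sum_abs sum_mono])
      fix k assume "k \<in> {..m}"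
      then have node: "real k / real m \<in> {0..1}" using m by auto
      show "\<bar>(S (?\<eta> (real k / real m)) - S \<theta> - \<kappa> * (real k / real m - x)) * Bernstein m k x\<bar>
          \<le> 48 * M / (x * (1 - x)) * ((real k / real m - x)\<^sup>2 * Bernstein m k x)"
        unfolding abs_mult mult.assoc[symmetric] abs_of_nonneg[OF pos]
        by (rule mult_right_mono[OF pt[OF node] pos])
    qed
    also have "\<dots> = 48 * M / (x * (1 - x)) * (x * (1 - x) / real m)"
      unfolding sum_distrib_left[symmetric] Bernstein_variance[OF m] ..
    also have "\<dots> = 48 * M / real m"
      using x01 by simp
    finally show ?thesis
      unfolding \<theta>_def[symmetric] linear_part_vanishes .
  qed
qed

text \<open>The smooth comparison function lives in the variable \<open>\<theta>\<close>: it is the Steklov mean of the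
  even periodic function \<open>\<theta> \<mapsto> F ((1 - cos \<theta>) / 2)\<close>. Periodicity removes the boundary, and the two
  centres of symmetry \<open>0\<close> and \<open>pi\<close> make the mean stationary there.\<close>

lemma Bernstein_approximation:
  assumes F: "continuous_on {0..1} F" and t: "0 < t" "t \<le> 1" and m: "0 < m" and x: "x \<in> {0..1}"
  shows "\<bar>(\<Sum>k\<le>m. F (real k / real m) * Bernstein m k x) - F x\<bar>
    \<le> (2 + 48 / (real m * t\<^sup>2)) * (omega2_phi F t + 4 * omega1 F (t\<^sup>2))"
proof -
  define W where "W = omega2_phi F t + 4 * omega1 F (t\<^sup>2)"
  define g where "g = (\<lambda>\<theta>. F ((1 - cos \<theta>) / 2))"
  let ?\<eta> = "\<lambda>y. arccos (1 - 2 * y)"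
  have g: "continuous_on UNIV g"
    unfolding g_def
    by (rule continuous_on_compose2[OF F]) (use cosine_point_in_unit_interval in \<open>auto intro!: continuous_intros\<close>)
  have W: "\<bar>g (\<theta> + h) - 2 * g \<theta> + g (\<theta> - h)\<bar> \<le> W" if "0 \<le> h" "h \<le> t" for \<theta> h
    unfolding g_def W_def using cosine_second_difference_le[OF F that t(2,1)] by simp
  obtain S S' S'' where
    S: "\<And>\<theta>. (S has_real_derivative S' \<theta>) (at \<theta>)"
    and S': "\<And>\<theta>. (S' has_real_derivative S'' \<theta>) (at \<theta>)"
    and M: "\<And>\<theta>. \<bar>S'' \<theta>\<bar> \<le> W / t\<^sup>2"
    and near: "\<And>\<theta>. \<bar>S \<theta> - g \<theta>\<bar> \<le> W"
    and sym: "\<And>a. (\<And>u. g (a + u) = g (a - u)) \<Longrightarrow> S' a = 0"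
    using steklov_mean[OF g t(1) W] by blast
  have stationary: "S' 0 = 0" "S' pi = 0"
    using sym[of 0] sym[of pi] by (simp_all add: g_def)
  have near_F: "\<bar>F y - S (?\<eta> y)\<bar> \<le> W" if "y \<in> {0..1}" for y
    using near[of "?\<eta> y"] that unfolding g_def by (simp add: abs_minus_commute)
  have "(\<Sum>k\<le>m. F (real k / real m) * Bernstein m k x) - F x
      = (\<Sum>k\<le>m. (F (real k / real m) - S (?\<eta> (real k / real m))) * Bernstein m k x)
        + (\<Sum>k\<le>m. (S (?\<eta> (real k / real m)) - S (?\<eta> x)) * Bernstein m k x)
        + (S (?\<eta> x) - F x)"
    by (simp add: left_diff_distrib sum_subtractf sum_distrib_left[symmetric])
  moreover have "\<bar>\<Sum>k\<le>m. (F (real k / real m) - S (?\<eta> (real k / real m))) * Bernstein m k x\<bar> \<le> W"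
    using m by (intro Bernstein_mean_le x near_F) auto
  moreover have "\<bar>\<Sum>k\<le>m. (S (?\<eta> (real k / real m)) - S (?\<eta> x)) * Bernstein m k x\<bar> \<le> 48 * (W / t\<^sup>2) / real m"
    by (rule Bernstein_smooth_in_angle[OF S S' M stationary m x])
  moreover have "\<bar>S (?\<eta> x) - F x\<bar> \<le> W"
    using near_F[OF x] by (simp add: abs_minus_commute)
  moreover have "(2 + 48 / (real m * t\<^sup>2)) * W = W + 48 * (W / t\<^sup>2) / real m + W"
    using t m by (simp add: field_simps)
  ultimately show ?thesis
    unfolding W_def[symmetric] by linarith
qed

section \<open>Derivatives of Bernstein forms\<close>

definition bernstein_form :: "(nat \<Rightarrow> real) \<Rightarrow> nat \<Rightarrow> real \<Rightarrow> real" where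
  "bernstein_form c n x = (\<Sum>k\<le>n. c k * Bernstein n k x)"

definition fdiff :: "(nat \<Rightarrow> real) \<Rightarrow> nat \<Rightarrow> real" where
  "fdiff c k = c (Suc k) - c k"

lemma Bernstein_has_derivative:
  "(Bernstein (Suc N) k has_real_derivative
     real (Suc N) * ((if k = 0 then 0 else Bernstein N (k - 1) x) - Bernstein N k x)) (at x)"
proof (cases "k \<le> Suc N")
  case True
  have B: "Bernstein (Suc N) k = (\<lambda>x. real (Suc N choose k) * x ^ k * (1 - x) ^ (Suc N - k))"
    by (simp add: Bernstein_def fun_eq_iff)
  have d: "((\<lambda>x. real (Suc N choose k) * x ^ k * (1 - x) ^ (Suc N - k)) has_real_derivative
      real (k * (Suc N choose k)) * x ^ (k - 1) * (1 - x) ^ (Suc N - k)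
      - real ((Suc N - k) * (Suc N choose k)) * x ^ k * (1 - x) ^ (Suc N - k - 1)) (at x)"
    by (rule derivative_eq_intros refl | simp)+
  have e1: "real (k * (Suc N choose k)) * x ^ (k - 1) * (1 - x) ^ (Suc N - k)
      = real (Suc N) * (if k = 0 then 0 else Bernstein N (k - 1) x)"
  proof (cases k)
    case (Suc j)
    then show ?thesis
      using Suc_times_binomial[of j N] unfolding Bernstein_def by (simp only: of_nat_mult) simp
  qed simp
  have e2: "real ((Suc N - k) * (Suc N choose k)) * x ^ k * (1 - x) ^ (Suc N - k - 1)
      = real (Suc N) * Bernstein N k x"
    using binomial_absorb_comp[of "Suc N" k] True unfolding Bernstein_def
    by (simp only: of_nat_mult) (simp add: diff_right_commute)
  show ?thesis
    unfolding B right_diff_distrib e1[symmetric] e2[symmetric] by (rule d)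
next
  case False
  then have "Bernstein (Suc N) k = (\<lambda>x. 0)" "Bernstein N k x = 0" "Bernstein N (k - 1) x = 0" "k \<noteq> 0"
    by (auto simp: Bernstein_def fun_eq_iff)
  then show ?thesis by simp
qed

lemma bernstein_form_has_derivative:
  "(bernstein_form c n has_real_derivative real n * bernstein_form (fdiff c) (n - 1) x) (at x)"
proof (cases n)
  case 0
  then show ?thesis
    by (simp add: bernstein_form_def [abs_def] Bernstein_def)
next
  case (Suc N)
  let ?B = "\<lambda>k. if k = 0 then 0 else Bernstein N (k - 1) x"
  have form: "bernstein_form c n = (\<lambda>x. \<Sum>k\<le>n. c k * Bernstein n k x)"
    by (simp add: bernstein_form_def fun_eq_iff)
  have "(bernstein_form c n has_real_derivative
      (\<Sum>k\<le>n. c k * (real n * (?B k - Bernstein N k x)))) (at x)"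
    unfolding form unfolding Suc by (intro DERIV_sum DERIV_cmult Bernstein_has_derivative)
  also have "(\<Sum>k\<le>n. c k * (real n * (?B k - Bernstein N k x)))
      = real n * ((\<Sum>k\<le>Suc N. c k * ?B k) - (\<Sum>k\<le>Suc N. c k * Bernstein N k x))"
    unfolding Suc sum_distrib_left sum_subtractf[symmetric]
    by (intro sum.cong refl) (simp add: algebra_simps)
  also have "(\<Sum>k\<le>Suc N. c k * ?B k) = (\<Sum>k\<le>N. c (Suc k) * Bernstein N k x)"
    unfolding sum.atMost_Suc_shift by simp
  also have "(\<Sum>k\<le>Suc N. c k * Bernstein N k x) = (\<Sum>k\<le>N. c k * Bernstein N k x)"
    by (simp add: Bernstein_def)
  also have "(\<Sum>k\<le>N. c (Suc k) * Bernstein N k x) - (\<Sum>k\<le>N. c k * Bernstein N k x)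
      = bernstein_form (fdiff c) (n - 1) x"
    unfolding bernstein_form_def fdiff_def by (simp add: Suc left_diff_distrib sum_subtractf)
  finally show ?thesis .
qed

lemma deriv01_0 [simp]: "deriv01 0 f = f"
  by (simp add: deriv01_def)

lemma deriv01_Suc: "deriv01 (Suc i) f x = vector_derivative (deriv01 i f) (at x within {0..1})"
  by (simp add: deriv01_def)

text \<open>The factors \<open>real (n - j)\<close> use truncated subtraction, so that both sides vanish once \<open>i\<close>
  exceeds the degree.\<close>

lemma deriv01_bernstein_form:
  "x \<in> {0..1} \<Longrightarrow> deriv01 i (bernstein_form c n) x
     = (\<Prod>j<i. real (n - j)) * bernstein_form ((fdiff ^^ i) c) (n - i) x"
proof (induction i arbitrary: x)
  case 0
  then show ?case by simp
next
  case (Suc i)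
  let ?P = "\<lambda>i. \<Prod>j<i. real (n - j)"
  have "((\<lambda>y. ?P i * bernstein_form ((fdiff ^^ i) c) (n - i) y) has_real_derivative
      ?P i * (real (n - i) * bernstein_form (fdiff ((fdiff ^^ i) c)) (n - i - 1) x)) (at x within {0..1})"
    by (intro DERIV_cmult has_field_derivative_at_within[OF bernstein_form_has_derivative])
  then have "(deriv01 i (bernstein_form c n) has_real_derivative
      ?P (Suc i) * bernstein_form ((fdiff ^^ Suc i) c) (n - Suc i) x) (at x within {0..1})"
    using Suc by (auto intro: has_field_derivative_transform_within[OF _ zero_less_one] simp: mult.assoc)
  then show ?case
    unfolding deriv01_Suc using Suc.prems
    by (intro vector_derivative_within_closed_interval)
       (auto simp: has_real_derivative_iff_has_vector_derivative)
qed

lemma Bhat_eq_bernstein_form: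
  "Bhat r n f = bernstein_form (\<lambda>k. of_int (r k (f (real k / real n) * real (n choose k))) / real (n choose k)) n"
  unfolding Bhat_def bernstein_form_def Bernstein_def
  by (auto simp: fun_eq_iff atMost_atLeast0 intro!: sum.cong)

lemma bernstein_form_add:
  "bernstein_form (\<lambda>k. a k + b k) n x = bernstein_form a n x + bernstein_form b n x"
  by (simp add: bernstein_form_def distrib_right sum.distrib)

lemma funpow_fdiff_add:
  "(fdiff ^^ i) (\<lambda>k. a k + b k) = (\<lambda>k. (fdiff ^^ i) a k + (fdiff ^^ i) b k)"
proof (induction i)
  case (Suc i)
  then show ?case by (simp add: fdiff_def [abs_def] algebra_simps)
qed simp

lemma funpow_fdiff_le:
  assumes "\<And>j. k \<le> j \<Longrightarrow> j \<le> k + i \<Longrightarrow> \<bar>c j\<bar> \<le> C"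
  shows "\<bar>(fdiff ^^ i) c k\<bar> \<le> 2 ^ i * C"
  using assms
proof (induction i arbitrary: k)
  case (Suc i)
  have "\<bar>(fdiff ^^ i) c (Suc k)\<bar> \<le> 2 ^ i * C" "\<bar>(fdiff ^^ i) c k\<bar> \<le> 2 ^ i * C"
    by (rule Suc.IH, rule Suc.prems; simp)+
  then show ?case by (simp add: fdiff_def [of "(fdiff ^^ i) c"])
qed simp

section \<open>Mean values for higher differences and Taylor remainders\<close>

lemma Cs01_has_derivative:
  assumes "f \<in> Cs01 s" "i < s" "x \<in> {0..1}"
  shows "(deriv01 i f has_real_derivative deriv01 (Suc i) f x) (at x within {0..1})"
proof -
  have "deriv01 i f differentiable (at x within {0..1})"
    using assms by (auto simp: Cs01_def differentiable_on_def)
  then show ?thesis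
    by (simp add: vector_derivative_works has_real_derivative_iff_has_vector_derivative deriv01_Suc)
qed

text \<open>A difference of order \<open>Suc s\<close> of \<open>D 0\<close> is a difference of order \<open>s\<close> of \<open>D 0 (y + h) - D 0 y\<close>,
  whose derivatives are the increments of the functions \<open>D i\<close>.\<close>

lemma higher_difference_mean_value:
  fixes D :: "nat \<Rightarrow> real \<Rightarrow> real"
  assumes "0 < h" "(real k + real s) * h \<le> b"
    and "\<And>i x. i < s \<Longrightarrow> x \<in> {0..b} \<Longrightarrow> (D i has_real_derivative D (Suc i) x) (at x within {0..b})"
  shows "\<exists>\<xi>\<in>{real k * h..(real k + real s) * h}. (fdiff ^^ s) (\<lambda>k. D 0 (real k * h)) k = h ^ s * D s \<xi>"
  using assms
proof (induction s arbitrary: D b)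
  case 0
  then show ?case by auto
next
  case (Suc s)
  define E where "E = (\<lambda>i y. D i (y + h) - D i y)"
  have E: "(E i has_real_derivative E (Suc i) x) (at x within {0..b - h})"
    if "i < s" "x \<in> {0..b - h}" for i x
  proof -
    have sub: "(\<lambda>y. y + h) ` {0..b - h} \<subseteq> {0..b}" "{0..b - h} \<subseteq> {0..b}"
      using Suc.prems(1) by auto
    have "(D i has_real_derivative D (Suc i) (x + h)) (at (x + h) within (\<lambda>y. y + h) ` {0..b - h})"
      using that Suc.prems(1) by (intro DERIV_subset[OF Suc.prems(3) sub(1)]) auto
    then have "(D i \<circ> (\<lambda>y. y + h) has_real_derivative D (Suc i) (x + h) * 1) (at x within {0..b - h})"
      by (rule DERIV_image_chain) (auto intro!: derivative_eq_intros)
    moreover have "(D i has_real_derivative D (Suc i) x) (at x within {0..b - h})"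
      using that Suc.prems(1) by (intro DERIV_subset[OF Suc.prems(3) sub(2)]) auto
    ultimately show ?thesis
      unfolding E_def o_def by (auto intro: DERIV_diff)
  qed
  have "(real k + real s) * h \<le> b - h"
    using Suc.prems(2) by (simp add: algebra_simps)
  then obtain \<xi> where \<xi>: "\<xi> \<in> {real k * h..(real k + real s) * h}"
    and eq: "(fdiff ^^ s) (\<lambda>k. E 0 (real k * h)) k = h ^ s * E s \<xi>"
    using Suc.IH[where D = E and b = "b - h", OF Suc.prems(1) _ E] by blast
  have "0 \<le> real k * h"
    using Suc.prems(1) by simp
  then have pos: "0 \<le> \<xi>"
    using \<xi> by (meson atLeastAtMost_iff order_trans)
  have fits: "(real k + real s) * h + h \<le> b"
    using Suc.prems(2) by (simp add: algebra_simps)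
  have "\<exists>z\<in>{\<xi><..<\<xi> + h}. D s (\<xi> + h) - D s \<xi> = D (Suc s) z * (\<xi> + h - \<xi>)"
  proof (rule mvt_simple)
    fix x assume "\<xi> \<le> x" "x \<le> \<xi> + h"
    then have "(D s has_real_derivative D (Suc s) x) (at x within {\<xi>..\<xi> + h})"
      using \<xi> pos fits by (intro DERIV_subset[OF Suc.prems(3)]) auto
    then show "(D s has_derivative (\<lambda>d. D (Suc s) x * d)) (at x within {\<xi>..\<xi> + h})"
      by (simp add: has_field_derivative_def)
  qed (use Suc.prems in simp)
  then obtain z where z: "z \<in> {\<xi><..<\<xi> + h}" "E s \<xi> = D (Suc s) z * h"
    unfolding E_def by auto
  have "fdiff (\<lambda>k. D 0 (real k * h)) = (\<lambda>k. E 0 (real k * h))"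
    by (simp add: fun_eq_iff fdiff_def E_def algebra_simps)
  then have "(fdiff ^^ Suc s) (\<lambda>k. D 0 (real k * h)) k = h ^ Suc s * D (Suc s) z"
    unfolding funpow_Suc_right o_def using eq z(2) by simp
  moreover have "z \<in> {real k * h..(real k + real (Suc s)) * h}"
    using z(1) \<xi> by (auto simp: algebra_simps)
  ultimately show ?case by blast
qed

text \<open>Taylor's estimate for a function that is flat at \<open>0\<close>, without the factorial: each of the
  \<open>s\<close> integrations costs a factor \<open>y\<close>.\<close>

lemma flat_function_le:
  fixes E :: "nat \<Rightarrow> real \<Rightarrow> real"
  assumes "\<And>i x. i < s \<Longrightarrow> x \<in> {0..y} \<Longrightarrow> (E i has_real_derivative E (Suc i) x) (at x within {0..y})"
    and "\<And>i. i < s \<Longrightarrow> E i 0 = 0" and "\<And>x. x \<in> {0..y} \<Longrightarrow> \<bar>E s x\<bar> \<le> M"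
  shows "x \<in> {0..y} \<Longrightarrow> \<bar>E 0 x\<bar> \<le> M * y ^ s"
  using assms
proof (induction s arbitrary: E x)
  case 0
  then show ?case by simp
next
  case (Suc s)
  have E1: "\<bar>E (Suc 0) z\<bar> \<le> M * y ^ s" if "z \<in> {0..y}" for z
    by (rule Suc.IH[of z "\<lambda>i. E (Suc i)"]) (use that Suc.prems in auto)
  have "norm (E 0 x - E 0 0) \<le> (M * y ^ s) * norm (x - 0)"
    using Suc.prems E1 by (intro field_differentiable_bound[where S = "{0..y}" and f' = "E (Suc 0)"]) auto
  also have "\<dots> \<le> (M * y ^ s) * y"
    using Suc.prems(1) E1[of 0] by (intro mult_left_mono) auto
  finally show ?case
    using Suc.prems(3)[of 0] by (simp add: mult_ac)
qed

lemma first_order_remainder_le: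
  fixes D :: "nat \<Rightarrow> real \<Rightarrow> real"
  assumes D: "\<And>i x. i < s \<Longrightarrow> x \<in> {0..y} \<Longrightarrow> (D i has_real_derivative D (Suc i) x) (at x within {0..y})"
    and s: "1 \<le> s" and D0: "\<And>i. 2 \<le> i \<Longrightarrow> i \<le> s \<Longrightarrow> D i 0 = 0"
    and M: "\<And>x. x \<in> {0..y} \<Longrightarrow> \<bar>D s x - D s 0\<bar> \<le> M" and y: "0 \<le> y"
  shows "\<bar>D 0 y - (D 0 0 + D 1 0 * y)\<bar> \<le> M * y ^ s"
proof -
  (* The Taylor polynomial of degree s at 0 is D 0 0 + D 1 0 * x; E i is the remainder's
     derivative of order i. *)
  define E where "E i x = (if i = 0 then D 0 x - (D 0 0 + D 1 0 * x) else if i = 1 then D 1 x - D 1 0 else D i x)"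
    for i x
  have "\<bar>E 0 y\<bar> \<le> M * y ^ s"
  proof (rule flat_function_le[where E = E])
    show "(E i has_real_derivative E (Suc i) x) (at x within {0..y})" if "i < s" "x \<in> {0..y}" for i x
    proof -
      consider "i = 0" | "i = 1" | "2 \<le> i" by linarith
      then show ?thesis
        using D[OF that]
        by cases (auto simp: E_def[abs_def] intro!: derivative_eq_intros)
    qed
    show "E i 0 = 0" if "i < s" for i
      using that D0[of i] by (auto simp: E_def)
    show "\<bar>E s x\<bar> \<le> M" if "x \<in> {0..y}" for x
      using M[OF that] s D0[of s] by (cases "s = 1") (auto simp: E_def)
  qed (use y in auto)
  then show ?thesis by (simp add: E_def)
qed

section \<open>The rounding error\<close>

lemma rounding_error_le:
  assumes "nearest_int_rule \<rho>" "0 < C" "q * C \<in> \<int>"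
  shows "\<bar>of_int (\<rho> (a * C)) / C - a\<bar> \<le> \<bar>a - q\<bar>"
proof -
  obtain m where "q * C = of_int m" using assms(3) by (auto elim: Ints_cases)
  then have "\<bar>a * C - of_int (\<rho> (a * C))\<bar> \<le> \<bar>a * C - q * C\<bar>"
    using assms(1) unfolding nearest_int_rule_def by metis
  also have "\<dots> = \<bar>a - q\<bar> * C"
    using assms(2) by (simp add: left_diff_distrib[symmetric] abs_mult)
  finally have "\<bar>a * C - of_int (\<rho> (a * C))\<bar> / C \<le> \<bar>a - q\<bar>"
    using assms(2) by (simp add: field_simps)
  moreover have "of_int (\<rho> (a * C)) / C - a = - ((a * C - of_int (\<rho> (a * C))) / C)"
    using assms(2) by (simp add: field_simps)
  ultimately show ?thesis
    using assms(2) by (simp add: abs_divide)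
qed

lemma rounding_error_le_half:
  assumes "nearest_int_rule \<rho>" "0 < C"
  shows "\<bar>of_int (\<rho> (a * C)) / C - a\<bar> \<le> 1 / (2 * C)"
proof -
  have "\<bar>of_int (\<rho> (a * C)) / C - a\<bar> \<le> \<bar>a - of_int (round (a * C)) / C\<bar>"
    using assms by (intro rounding_error_le) auto
  also have "\<dots> = \<bar>of_int (round (a * C)) - a * C\<bar> / C"
  proof -
    have "a - of_int (round (a * C)) / C = - ((of_int (round (a * C)) - a * C) / C)"
      using assms(2) by (simp add: field_simps)
    then show ?thesis using assms(2) by (simp add: abs_divide)
  qed
  also have "\<dots> \<le> (1 / 2) / C"
    using assms(2) of_int_round_abs_le[of "a * C"] by (intro divide_right_mono) auto
  finally show ?thesis by simp
qed

lemma linear_times_binomial_in_Ints: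
  assumes "i0 \<in> \<int>" "i1 \<in> \<int>" "1 \<le> n"
  shows "(i0 + i1 * (real k / real n)) * real (n choose k) \<in> \<int>"
proof -
  have "real k / real n * real (n choose k) \<in> \<int>"
  proof (cases k)
    case (Suc j)
    then have "k * (n choose k) = n * (n - 1 choose (k - 1))"
      by (intro times_binomial_minus1_eq) auto
    then have "real k * real (n choose k) = real n * real (n - 1 choose (k - 1))"
      by (metis of_nat_mult)
    then have "real k / real n * real (n choose k) = real (n - 1 choose (k - 1))"
      using assms(3) by (simp add: field_simps)
    then show ?thesis by simp
  qed simp
  from Ints_add[OF Ints_mult[OF assms(1) Ints_of_nat] Ints_mult[OF assms(2) this]]
  have "i0 * real (n choose k) + i1 * (real k / real n * real (n choose k)) \<in> \<int>" .
  then show ?thesis by (simp add: algebra_simps)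
qed

lemma binomial_between_ge:
  assumes "k \<le> n" "j \<le> k" "j \<le> n - k"
  shows "n choose j \<le> n choose k"
proof (cases "2 * k \<le> n")
  case True
  then show ?thesis using assms by (intro binomial_mono) auto
next
  case False
  then have "n choose j \<le> n choose (n - k)"
    using assms by (intro binomial_mono) auto
  then show ?thesis using binomial_symmetric[OF assms(1)] by simp
qed

text \<open>Near \<open>0\<close> the function differs from \<open>f 0 + deriv01 1 f 0 * x\<close> by its Taylor remainder of
  order \<open>s\<close>, and at \<open>k / n\<close> this line times \<open>n choose k\<close> is an integer; a nearest integer does at
  least as well. The same holds near \<open>1\<close>. For the other indices the binomial coefficient is at
  least \<open>(n / (s + 1)) ^ (s + 1)\<close>, and rounding is divided by it.\<close>

lemma rounding_error_scaled_le:
  assumes f: "f \<in> Cs01 s" and s: "1 \<le> s" and n: "1 \<le> n" and k: "k \<le> n" and \<rho>: "nearest_int_rule \<rho>"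
    and ints: "f 0 \<in> \<int>" "f 1 \<in> \<int>" "deriv01 1 f 0 \<in> \<int>" "deriv01 1 f 1 \<in> \<int>"
    and flat: "\<forall>i\<in>{2..s}. deriv01 i f 0 = 0 \<and> deriv01 i f 1 = 0"
  shows "real n ^ s * \<bar>of_int (\<rho> (f (real k / real n) * real (n choose k))) / real (n choose k) - f (real k / real n)\<bar>
    \<le> real (s + 1) ^ (s + 1) * (omega1 (deriv01 s f) (1 / real n) + 1 / real n)"
proof -
  define F where "F = deriv01 s f"
  define \<omega> where "\<omega> = omega1 F (1 / real n)"
  define b where "b = of_int (\<rho> (f (real k / real n) * real (n choose k))) / real (n choose k) - f (real k / real n)"
  have F: "continuous_on {0..1} F" using f unfolding Cs01_def F_def by simp
  have \<omega>0: "0 \<le> \<omega>" unfolding \<omega>_def by (rule omega1_nonneg[OF F]) simp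
  have C0: "0 < real (n choose k)" using k by simp
  note D = Cs01_has_derivative[OF f]
  have near_endpoint: "real n ^ s * \<bar>b\<bar> \<le> real (s + 1) ^ (s + 1) * \<omega>"
    if b: "\<bar>b\<bar> \<le> real s * \<omega> * (real j / real n) ^ s" and j: "j \<le> s" for j
  proof -
    have "real n ^ s * \<bar>b\<bar> \<le> real n ^ s * (real s * \<omega> * (real j / real n) ^ s)"
      using b by (intro mult_left_mono) auto
    also have "\<dots> = real s * real j ^ s * \<omega>"
      using n by (simp add: power_divide)
    also have "\<dots> \<le> real (s + 1) * real (s + 1) ^ s * \<omega>"
      using j \<omega>0 by (intro mult_right_mono mult_mono power_mono) auto
    finally show ?thesis by simp
  qed
  consider "k \<le> s" | "n - k \<le> s" | "s < k" "s < n - k" by linarith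
  then have "real n ^ s * \<bar>b\<bar> \<le> real (s + 1) ^ (s + 1) * (\<omega> + 1 / real n)"
  proof cases
    case 1
    let ?y = "real k / real n"
    have y: "0 \<le> ?y" "?y \<le> 1" using k n by auto
    have "\<bar>deriv01 0 f ?y - (deriv01 0 f 0 + deriv01 1 f 0 * ?y)\<bar> \<le> real s * \<omega> * ?y ^ s"
    proof (rule first_order_remainder_le[OF _ s])
      fix x assume x: "x \<in> {0..?y}"
      show "(deriv01 i f has_real_derivative deriv01 (Suc i) f x) (at x within {0..?y})" if "i < s" for i
        using x y by (intro DERIV_subset[OF D[OF that]]) auto
      have "?y \<le> real s * (1 / real n)"
        using 1 n by (simp add: divide_right_mono)
      then have "\<bar>x - 0\<bar> \<le> real s * (1 / real n)" using x by simp
      then show "\<bar>deriv01 s f x - deriv01 s f 0\<bar> \<le> real s * \<omega>"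
        unfolding \<omega>_def F_def[symmetric] using x y by (intro omega1_chain[OF F]) auto
    qed (use flat y in auto)
    then have "\<bar>f ?y - (f 0 + deriv01 1 f 0 * ?y)\<bar> \<le> real s * \<omega> * ?y ^ s" by simp
    then have "\<bar>b\<bar> \<le> real s * \<omega> * ?y ^ s"
      using rounding_error_le[OF \<rho> C0 linear_times_binomial_in_Ints[OF ints(1,3) n], of "f ?y"]
      unfolding b_def by linarith
    then have "real n ^ s * \<bar>b\<bar> \<le> real (s + 1) ^ (s + 1) * \<omega>"
      using 1 by (rule near_endpoint)
    also have "\<dots> \<le> real (s + 1) ^ (s + 1) * (\<omega> + 1 / real n)"
      by (intro mult_left_mono) auto
    finally show ?thesis .
  next
    case 2
    let ?y = "real (n - k) / real n"
    define R where "R i x = (- 1) ^ i * deriv01 i f (1 - x)" for i x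
    have y: "0 \<le> ?y" "?y \<le> 1" "1 - ?y = real k / real n" using k n by (auto simp: field_simps of_nat_diff)
    have "\<bar>R 0 ?y - (R 0 0 + R 1 0 * ?y)\<bar> \<le> real s * \<omega> * ?y ^ s"
    proof (rule first_order_remainder_le[OF _ s])
      fix x assume x: "x \<in> {0..?y}"
      show "(R i has_real_derivative R (Suc i) x) (at x within {0..?y})" if "i < s" for i
      proof -
        have "(deriv01 i f has_real_derivative deriv01 (Suc i) f (1 - x)) (at (1 - x) within (\<lambda>x. 1 - x) ` {0..?y})"
          using x y by (intro DERIV_subset[OF D[OF that]]) auto
        then have "(deriv01 i f \<circ> (\<lambda>x. 1 - x) has_real_derivative deriv01 (Suc i) f (1 - x) * (- 1)) (at x within {0..?y})"
          by (rule DERIV_image_chain) (auto intro!: derivative_eq_intros)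
        from DERIV_cmult[OF this, of "(- 1) ^ i"] show ?thesis
          unfolding R_def[abs_def] o_def by simp
      qed
      have "?y \<le> real s * (1 / real n)"
        using 2 n by (simp add: divide_right_mono)
      then have "\<bar>(1 - x) - 1\<bar> \<le> real s * (1 / real n)" using x by simp
      then have "\<bar>F (1 - x) - F 1\<bar> \<le> real s * \<omega>"
        unfolding \<omega>_def using x y by (intro omega1_chain[OF F]) auto
      then show "\<bar>R s x - R s 0\<bar> \<le> real s * \<omega>"
        unfolding R_def F_def[symmetric] by (simp add: right_diff_distrib[symmetric] abs_mult power_abs)
    qed (use flat y in \<open>auto simp: R_def\<close>)
    then have "\<bar>f (real k / real n) - (f 1 + (- deriv01 1 f 1) * ?y)\<bar> \<le> real s * \<omega> * ?y ^ s"
      unfolding R_def y(3) by simp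
    moreover have "(f 1 + (- deriv01 1 f 1) * ?y) * real (n choose k) \<in> \<int>"
      unfolding binomial_symmetric[OF k]
      by (rule linear_times_binomial_in_Ints) (use ints n in auto)
    ultimately have "\<bar>b\<bar> \<le> real s * \<omega> * ?y ^ s"
      using rounding_error_le[OF \<rho> C0, of "f 1 + (- deriv01 1 f 1) * ?y" "f (real k / real n)"]
      unfolding b_def by linarith
    then have "real n ^ s * \<bar>b\<bar> \<le> real (s + 1) ^ (s + 1) * \<omega>"
      using 2 by (rule near_endpoint)
    also have "\<dots> \<le> real (s + 1) ^ (s + 1) * (\<omega> + 1 / real n)"
      by (intro mult_left_mono) auto
    finally show ?thesis .
  next
    case 3
    have "(real n / real (s + 1)) ^ (s + 1) \<le> real (n choose (s + 1))"
      using 3 by (intro binomial_ge_n_over_k_pow_k) auto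
    also have "\<dots> \<le> real (n choose k)"
      using binomial_between_ge[OF k, of "s + 1"] 3 by (simp only: of_nat_le_iff)
    finally have C: "(real n / real (s + 1)) ^ (s + 1) \<le> real (n choose k)" .
    have "real n ^ s * \<bar>b\<bar> \<le> real n ^ s * (1 / (2 * real (n choose k)))"
      unfolding b_def by (intro mult_left_mono rounding_error_le_half[OF \<rho> C0]) auto
    also have "\<dots> \<le> real n ^ s * (1 / (real n / real (s + 1)) ^ (s + 1))"
      using C C0 n by (intro mult_left_mono divide_left_mono mult_pos_pos) auto
    also have "\<dots> = real (s + 1) ^ (s + 1) * (1 / real n)"
      using n by (simp add: power_divide)
    also have "\<dots> \<le> real (s + 1) ^ (s + 1) * (\<omega> + 1 / real n)"
      using \<omega>0 by (intro mult_left_mono) auto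
    finally show ?thesis .
  qed
  then show ?thesis unfolding b_def \<omega>_def F_def .
qed

section \<open>Simultaneous approximation\<close>

text \<open>The factor in front of the differences of order \<open>s\<close> is \<open>n ^ s\<close> up to a relative error that
  is the source of the term with the norm. The error has the factor \<open>s - 1\<close>, hence it vanishes for
  \<open>s = 1\<close>.\<close>

lemma falling_factorial_ratio:
  assumes "1 \<le> n"
  shows "1 - real (s * (s - 1)) / real n \<le> (\<Prod>j<s. real (n - j)) / real n ^ s"
    and "(\<Prod>j<s. real (n - j)) / real n ^ s \<le> 1"
proof -
  define q where "q s = (\<Prod>j<s. real (n - j)) / real n ^ s" for s
  have q: "q (Suc s) = q s * (real (n - s) / real n)" for s
    by (simp add: q_def)
  have q01: "0 \<le> q s" "q s \<le> 1" for s
  proof (induction s)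
    case (Suc s)
    have "0 \<le> real (n - s) / real n" "real (n - s) / real n \<le> 1" using assms by auto
    with Suc show "0 \<le> q (Suc s)" "q (Suc s) \<le> 1"
      unfolding q by (blast intro: mult_nonneg_nonneg mult_le_one)+
  qed (simp_all add: q_def)
  have "1 - real (s * (s - 1)) / real n \<le> q s"
  proof (induction s)
    case (Suc s)
    have "(real n - real s) / real n \<le> real (n - s) / real n"
      by (intro divide_right_mono) linarith+
    then have "1 - real s / real n \<le> real (n - s) / real n"
      using assms by (simp add: diff_divide_distrib)
    then have "q s * (1 - real s / real n) \<le> q (Suc s)"
      unfolding q by (intro mult_left_mono q01)
    moreover have "q s * (real s / real n) \<le> 1 * (real s / real n)"
      by (intro mult_right_mono q01) auto
    moreover have "real (Suc s * (Suc s - 1)) / real n = real (s * (s - 1)) / real n + 2 * (real s / real n)"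
      by (cases s) (simp_all add: add_divide_distrib[symmetric] algebra_simps)
    moreover have "0 \<le> real s / real n" by simp
    ultimately show ?case using Suc by (simp only: right_diff_distrib mult_1_right mult_1_left)
  qed (simp add: q_def)
  then show "1 - real (s * (s - 1)) / real n \<le> (\<Prod>j<s. real (n - j)) / real n ^ s"
    by (simp add: q_def)
  show "(\<Prod>j<s. real (n - j)) / real n ^ s \<le> 1"
    using q01(2)[of s] by (simp add: q_def)
qed

text \<open>A mean of values \<open>F (\<xi> k)\<close>, with \<open>\<xi> k\<close> between \<open>k / n\<close> and \<open>(k + s) / n\<close>, is as good as the
  Bernstein polynomial of degree \<open>n - s\<close>, because \<open>\<xi> k\<close> and \<open>k / (n - s)\<close> both lie in that
  interval. For \<open>n = s\<close> there is a single node, and \<open>[0,1]\<close> is covered by \<open>s\<close> steps of length \<open>1 / n\<close>.\<close>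

lemma Bernstein_displaced_nodes:
  assumes F: "continuous_on {0..1} F" and n: "1 \<le> n" "s \<le> n" and x: "x \<in> {0..1}"
    and \<xi>: "\<And>k. k \<le> n - s \<Longrightarrow> \<xi> k \<in> {real k / real n..(real k + real s) / real n}"
  shows "\<bar>(\<Sum>k\<le>n - s. F (\<xi> k) * Bernstein (n - s) k x) - F x\<bar>
    \<le> real s * omega1 F (1 / real n)
      + (50 + 48 * real s) * (omega2_phi F (real n powr (- 1 / 2)) + 4 * omega1 F (1 / real n))"
proof -
  define t where "t = real n powr (- 1 / 2)"
  have t: "0 < t" "t \<le> 1" "t\<^sup>2 = 1 / real n"
  proof -
    have "t\<^sup>2 = real n powr (- 1)"
      unfolding t_def using n by (simp add: power2_eq_square powr_add[symmetric])
    then show t2: "t\<^sup>2 = 1 / real n"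
      using n by (simp add: powr_minus_divide)
    show "0 < t" unfolding t_def using n by simp
    have "t\<^sup>2 \<le> 1\<^sup>2" unfolding t2 using n by simp
    then show "t \<le> 1" by (rule power2_le_imp_le) simp
  qed
  define W where "W = omega2_phi F t + 4 * omega1 F (1 / real n)"
  have W0: "0 \<le> W"
    unfolding W_def using omega2_phi_nonneg[OF F t(1)] omega1_nonneg[OF F, of "1 / real n"] by simp
  have in01: "\<xi> k \<in> {0..1}" if "k \<le> n - s" for k
  proof -
    have "(real k + real s) / real n \<le> 1" "0 \<le> real k / real n"
      using that n by (auto simp: field_simps)
    then show ?thesis using \<xi>[OF that] by (meson atLeastAtMost_iff order_trans)
  qed
  have "\<bar>(\<Sum>k\<le>n - s. F (\<xi> k) * Bernstein (n - s) k x) - F x\<bar>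
      \<le> real s * omega1 F (1 / real n) + (50 + 48 * real s) * W"
  proof (cases "n = s")
    case True
    have "\<bar>F (\<xi> 0) - F x\<bar> \<le> real s * omega1 F (1 / real n)"
      using in01[of 0] x n True by (intro omega1_chain[OF F]) auto
    moreover have "0 \<le> (50 + 48 * real s) * W" using W0 by simp
    ultimately show ?thesis using True by (simp add: Bernstein_def)
  next
    case False
    define m where "m = n - s"
    have m: "0 < m" "real n = real m + real s" using False n unfolding m_def by auto
    have displaced: "\<bar>F (\<xi> k) - F (real k / real m)\<bar> \<le> real s * omega1 F (1 / real n)" if k: "k \<le> m" for k
    proof (rule omega1_chain[OF F])
      have "real k / real n \<le> real k / real m" "real k / real m \<le> (real k + real s) / real n"
        using m k n by (auto simp: field_simps mult_right_mono)
      moreover have "real k / real n \<le> \<xi> k" "\<xi> k \<le> (real k + real s) / real n"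
        using \<xi>[of k] k unfolding m_def by auto
      moreover have "(real k + real s) / real n = real k / real n + real s * (1 / real n)"
        by (simp add: add_divide_distrib)
      ultimately show "\<bar>\<xi> k - real k / real m\<bar> \<le> real s * (1 / real n)"
        by linarith
    qed (use in01 k m in \<open>auto simp: m_def\<close>)
    have "(\<Sum>k\<le>m. F (\<xi> k) * Bernstein m k x) - F x
        = (\<Sum>k\<le>m. (F (\<xi> k) - F (real k / real m)) * Bernstein m k x)
          + ((\<Sum>k\<le>m. F (real k / real m) * Bernstein m k x) - F x)"
      by (simp add: left_diff_distrib sum_subtractf)
    moreover have "\<bar>\<Sum>k\<le>m. (F (\<xi> k) - F (real k / real m)) * Bernstein m k x\<bar> \<le> real s * omega1 F (1 / real n)"
      by (rule Bernstein_mean_le[OF x displaced])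
    moreover have "\<bar>(\<Sum>k\<le>m. F (real k / real m) * Bernstein m k x) - F x\<bar> \<le> (2 + 48 / (real m * t\<^sup>2)) * W"
      unfolding W_def using Bernstein_approximation[OF F t(1,2) m(1) x] by (simp only: t(3))
    moreover have "(2 + 48 / (real m * t\<^sup>2)) * W \<le> (50 + 48 * real s) * W"
    proof (rule mult_right_mono[OF _ W0])
      have "real m + real s \<le> (1 + real s) * real m"
        using m(1) mult_left_mono[of 1 "real m" "real s"] by (simp add: algebra_simps)
      then have "real n / real m \<le> 1 + real s"
        using m by (simp add: field_simps)
      then show "2 + 48 / (real m * t\<^sup>2) \<le> 50 + 48 * real s"
        unfolding t(3) by simp
    qed
    ultimately show ?thesis
      unfolding m_def[symmetric] by linarith
  qed
  then show ?thesis unfolding W_def t_def .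
qed

text \<open>With \<open>u k = f (k / n)\<close> and \<open>b k\<close> the rounding error of the coefficient divided by
  \<open>n choose k\<close>, the derivative of order \<open>s\<close> splits into the rounding part, the mean of values of
  \<open>deriv01 s f\<close> at displaced nodes, and the defect of the factor \<open>q\<close>. If \<open>n < s\<close>, then \<open>q = 0\<close> and the
  defect is everything.\<close>

lemma Bhat_deriv_error:
  fixes f :: "real \<Rightarrow> real" and r :: "nat \<Rightarrow> real \<Rightarrow> int"
  assumes f: "f \<in> Cs01 s" and s: "1 \<le> s" and n: "1 \<le> n" and r: "\<forall>k. nearest_int_rule (r k)"
    and ints: "f 0 \<in> \<int>" "f 1 \<in> \<int>" "deriv01 1 f 0 \<in> \<int>" "deriv01 1 f 1 \<in> \<int>"
    and flat: "\<forall>i\<in>{2..s}. deriv01 i f 0 = 0 \<and> deriv01 i f 1 = 0"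
    and x: "x \<in> {0..1}"
  defines "F \<equiv> deriv01 s f"
  shows "\<bar>deriv01 s (Bhat r n f) x - F x\<bar>
    \<le> 2 ^ s * (real (s + 1) ^ (s + 1) * (omega1 F (1 / real n) + 1 / real n))
      + (real s * omega1 F (1 / real n)
         + (50 + 48 * real s) * (omega2_phi F (real n powr (- 1 / 2)) + 4 * omega1 F (1 / real n)))
      + real (s * (s - 1)) / real n * supnorm01 F"
    (is "_ \<le> ?R + ?A + ?N")
proof -
  have F: "continuous_on {0..1} F" using f unfolding Cs01_def F_def by simp
  define m where "m = n - s"
  define q where "q = (\<Prod>j<s. real (n - j)) / real n ^ s"
  have P: "(\<Prod>j<s. real (n - j)) = q * real n ^ s" using n by (simp add: q_def)
  have q: "0 \<le> q" "q \<le> 1" "1 - q \<le> real (s * (s - 1)) / real n"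
    using falling_factorial_ratio[OF n, of s] unfolding q_def by (auto intro!: divide_nonneg_nonneg prod_nonneg)
  have q0: "q = 0" if "n < s"
    unfolding q_def using that by (auto simp: prod_zero_iff)
  have A0: "0 \<le> ?A" and R0: "0 \<le> ?R"
    using omega1_nonneg[OF F, of "1 / real n"] omega2_phi_nonneg[OF F, of "real n powr (- 1 / 2)"] n by auto
  define u where "u k = f (real k / real n)" for k
  define b where "b k = of_int (r k (u k * real (n choose k))) / real (n choose k) - u k" for k
  define R A where "R = real n ^ s * bernstein_form ((fdiff ^^ s) b) m x"
    and "A = real n ^ s * bernstein_form ((fdiff ^^ s) u) m x"
  have "Bhat r n f = bernstein_form (\<lambda>k. u k + b k) n"
    unfolding Bhat_eq_bernstein_form u_def b_def by simp
  then have "deriv01 s (Bhat r n f) x - F x = q * R + q * (A - F x) + (q - 1) * F x"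
    unfolding R_def A_def
    by (simp add: deriv01_bernstein_form[OF x] P funpow_fdiff_add bernstein_form_add m_def algebra_simps)
  moreover have "\<bar>q * R\<bar> \<le> ?R"
  proof (cases "n < s")
    case True
    then show ?thesis using q0 R0 by simp
  next
    case False
    have "\<bar>bernstein_form (\<lambda>k. real n ^ s * (fdiff ^^ s) b k) m x\<bar> \<le> ?R"
      unfolding bernstein_form_def
    proof (rule Bernstein_mean_le[OF x])
      fix k assume "k \<le> m"
      let ?C = "real (s + 1) ^ (s + 1) * (omega1 F (1 / real n) + 1 / real n)"
      have "\<bar>(fdiff ^^ s) b k\<bar> \<le> 2 ^ s * (?C / real n ^ s)"
      proof (rule funpow_fdiff_le)
        fix j assume "k \<le> j" "j \<le> k + s"
        then have "j \<le> n" using \<open>k \<le> m\<close> False unfolding m_def by linarith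
        then have "real n ^ s * \<bar>b j\<bar> \<le> ?C"
          unfolding b_def u_def F_def using r by (intro rounding_error_scaled_le[OF f s n _ _ ints flat]) auto
        then show "\<bar>b j\<bar> \<le> ?C / real n ^ s"
          using n by (simp add: pos_le_divide_eq mult.commute)
      qed
      then have "real n ^ s * \<bar>(fdiff ^^ s) b k\<bar> \<le> real n ^ s * (2 ^ s * (?C / real n ^ s))"
        by (intro mult_left_mono) auto
      then show "\<bar>real n ^ s * (fdiff ^^ s) b k\<bar> \<le> ?R"
        using n by (simp add: abs_mult)
    qed
    then have "\<bar>R\<bar> \<le> ?R"
      unfolding R_def bernstein_form_def by (simp add: sum_distrib_left mult.assoc)
    moreover have "\<bar>q * R\<bar> \<le> 1 * \<bar>R\<bar>"
      unfolding abs_mult using q by (intro mult_right_mono) auto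
    ultimately show ?thesis unfolding mult_1_left by (rule order_trans[rotated])
  qed
  moreover have "\<bar>q * (A - F x)\<bar> \<le> ?A"
  proof (cases "n < s")
    case True
    then show ?thesis using q0 A0 by simp
  next
    case False
    have "\<exists>\<xi>. \<xi> \<in> {real k / real n..(real k + real s) / real n} \<and> (fdiff ^^ s) u k = (1 / real n) ^ s * F \<xi>"
      if "k \<le> n - s" for k
      using higher_difference_mean_value[where D = "\<lambda>i. deriv01 i f" and h = "1 / real n" and k = k and s = s and b = 1]
        Cs01_has_derivative[OF f] that n False
      unfolding u_def F_def by (fastforce simp: field_simps)
    then obtain \<xi> where \<xi>: "\<And>k. k \<le> n - s \<Longrightarrow> \<xi> k \<in> {real k / real n..(real k + real s) / real n}"
      "\<And>k. k \<le> n - s \<Longrightarrow> (fdiff ^^ s) u k = (1 / real n) ^ s * F (\<xi> k)"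
      by metis
    have "A = (\<Sum>k\<le>n - s. F (\<xi> k) * Bernstein (n - s) k x)"
      unfolding A_def bernstein_form_def m_def sum_distrib_left
      using n by (intro sum.cong refl) (simp add: \<xi>(2) power_one_over)
    then have "\<bar>A - F x\<bar> \<le> ?A"
      using Bernstein_displaced_nodes[OF F n _ x \<xi>(1)] False by simp
    moreover have "\<bar>q * (A - F x)\<bar> \<le> 1 * \<bar>A - F x\<bar>"
      unfolding abs_mult using q by (intro mult_right_mono) auto
    ultimately show ?thesis unfolding mult_1_left by (rule order_trans[rotated])
  qed
  moreover have "\<bar>(q - 1) * F x\<bar> \<le> ?N"
    unfolding abs_mult using q supnorm01_upper[OF F x] by (intro mult_mono) auto
  ultimately show ?thesis by linarith
qed

theorem theorem1p2:
  fixes s :: nat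
  assumes "s \<ge> 1"
  shows "\<exists>c::real. c > 0 \<and>
    (\<forall>f \<in> Cs01 s. \<forall>n::nat. \<forall>r :: nat \<Rightarrow> real \<Rightarrow> int.
       f 0 \<in> \<int> \<longrightarrow> f 1 \<in> \<int> \<longrightarrow> deriv01 1 f 0 \<in> \<int> \<longrightarrow> deriv01 1 f 1 \<in> \<int> \<longrightarrow>
       (\<forall>i\<in>{2..s}. deriv01 i f 0 = 0 \<and> deriv01 i f 1 = 0) \<longrightarrow>
       n \<ge> 1 \<longrightarrow> (\<forall>k. nearest_int_rule (r k)) \<longrightarrow>
       (s = 1 \<longrightarrow>
          supnorm01 (\<lambda>x. deriv01 1 (Bhat r n f) x - deriv01 1 f x)
            \<le> c * (omega2_phi (deriv01 1 f) (real n powr (- 1 / 2))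
                   + omega1 (deriv01 1 f) (1 / real n) + 1 / real n)) \<and>
       (s \<ge> 2 \<longrightarrow>
          supnorm01 (\<lambda>x. deriv01 s (Bhat r n f) x - deriv01 s f x)
            \<le> c * (omega2_phi (deriv01 s f) (real n powr (- 1 / 2))
                   + omega1 (deriv01 s f) (1 / real n)
                   + 1 / real n * supnorm01 (deriv01 s f) + 1 / real n)))"
proof -
  define K where "K = 2 ^ s * real (s + 1) ^ (s + 1)"
  define L where "L = 50 + 48 * real s"
  define c where "c = K + real s + 4 * L + real (s * (s - 1))"
  have pos: "0 < K" "0 < L" unfolding K_def L_def by auto
  have bound: "supnorm01 (\<lambda>x. deriv01 s (Bhat r n f) x - deriv01 s f x)
      \<le> c * (omega2_phi (deriv01 s f) (real n powr (- 1 / 2)) + omega1 (deriv01 s f) (1 / real n) + 1 / real n)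
        + real (s * (s - 1)) * (1 / real n * supnorm01 (deriv01 s f))"
    if f: "f \<in> Cs01 s" and ints: "f 0 \<in> \<int>" "f 1 \<in> \<int>" "deriv01 1 f 0 \<in> \<int>" "deriv01 1 f 1 \<in> \<int>"
      and flat: "\<forall>i\<in>{2..s}. deriv01 i f 0 = 0 \<and> deriv01 i f 1 = 0"
      and n: "1 \<le> n" and r: "\<forall>k. nearest_int_rule (r k)"
    for f :: "real \<Rightarrow> real" and n :: nat and r :: "nat \<Rightarrow> real \<Rightarrow> int"
  proof (rule supnorm01_least)
    fix x :: real assume x: "x \<in> {0..1}"
    define w v e where "w = omega2_phi (deriv01 s f) (real n powr (- 1 / 2))"
      and "v = omega1 (deriv01 s f) (1 / real n)" and "e = 1 / real n"
    have F: "continuous_on {0..1} (deriv01 s f)" using f unfolding Cs01_def by simp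
    have nonneg: "0 \<le> w" "0 \<le> v" "0 \<le> e"
      unfolding w_def v_def e_def using n by (auto intro!: omega2_phi_nonneg[OF F] omega1_nonneg[OF F])
    have "L * w \<le> c * w" "(K + real s + 4 * L) * v \<le> c * v" "K * e \<le> c * e"
      using pos nonneg unfolding c_def by (intro mult_right_mono; simp)+
    then have "K * (v + e) + (real s * v + L * (w + 4 * v)) \<le> c * (w + v + e)"
      by (simp add: algebra_simps)
    then show "\<bar>deriv01 s (Bhat r n f) x - deriv01 s f x\<bar> \<le> c * (w + v + 1 / real n)
        + real (s * (s - 1)) * (1 / real n * supnorm01 (deriv01 s f))"
      using Bhat_deriv_error[OF f assms n r ints flat x]
      unfolding w_def[symmetric] v_def[symmetric] L_def[symmetric] e_def K_def by (simp add: mult.assoc)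
  qed
  show ?thesis
  proof (intro exI[of _ c] conjI ballI allI impI)
    show "0 < c" unfolding c_def using pos of_nat_0_le_iff[of s] of_nat_0_le_iff[of "s * (s - 1)"] by linarith
  next
    fix f :: "real \<Rightarrow> real" and n :: nat and r :: "nat \<Rightarrow> real \<Rightarrow> int"
    assume f: "f \<in> Cs01 s" and ints: "f 0 \<in> \<int>" "f 1 \<in> \<int>" "deriv01 1 f 0 \<in> \<int>" "deriv01 1 f 1 \<in> \<int>"
      and flat: "\<forall>i\<in>{2..s}. deriv01 i f 0 = 0 \<and> deriv01 i f 1 = 0"
      and n: "1 \<le> n" and r: "\<forall>k. nearest_int_rule (r k)"
    note bd = bound[OF f ints flat n r]
    {
      assume "s = 1"
      then show "supnorm01 (\<lambda>x. deriv01 1 (Bhat r n f) x - deriv01 1 f x)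
          \<le> c * (omega2_phi (deriv01 1 f) (real n powr (- 1 / 2)) + omega1 (deriv01 1 f) (1 / real n) + 1 / real n)"
        using bd by simp
    next
      assume "2 \<le> s"
      have "continuous_on {0..1} (deriv01 s f)" using f unfolding Cs01_def by simp
      from supnorm01_upper[OF this, of 0] have "0 \<le> 1 / real n * supnorm01 (deriv01 s f)"
        by simp
      then have "real (s * (s - 1)) * (1 / real n * supnorm01 (deriv01 s f))
          \<le> c * (1 / real n * supnorm01 (deriv01 s f))"
        unfolding c_def using pos by (intro mult_right_mono) auto
      then show "supnorm01 (\<lambda>x. deriv01 s (Bhat r n f) x - deriv01 s f x)
          \<le> c * (omega2_phi (deriv01 s f) (real n powr (- 1 / 2)) + omega1 (deriv01 s f) (1 / real n)
                 + 1 / real n * supnorm01 (deriv01 s f) + 1 / real n)"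
        using bd by (simp add: distrib_left)
    }
  qed
qed

end
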